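(* Let $(A,\circ,\rho,\langle\cdot,\cdot\rangle)$ be a Courant algebroid over $M$ and let $N:A\to A$ be a $(1,1)$-tensor. Put $X\circ_NY=N(X)\circ Y+X\circ N(Y)-N(X\circ Y)$ and $\rho_N=\rho\circ N$ (composition of bundle maps). Then the contracted product $\circ_N$ is compatible with the pairing in the sense that $$\rho_N(X)\langle Y,Y\rangle=2\langle X,Y\circ_N Y\rangle\quad\text{and}\quad \rho_N(X)\langle Y,Y\rangle=2\langle X\circ_N Y,Y\rangle$$ for all sections $X,Y$ of $A$, if and only if $$X\circ (N+N^* )Y=(N+N^* )(X\circ Y)\quad\text{and}\quad (N+N^* )(Y\circ Y)=\big((N+N^* )Y\big)\circ Y$$ for all sections $X,Y$ of $A$.
   Context: A Leibniz product on a vector space is a bilinear operation $\circ$ with $(X\circ Y)\circ Z=X\circ(Y\circ Z)-Y\circ(X\circ Z)$. A Courant algebroid is a vector bundle $A\to M$ with a Leibniz product $\circ$ on $Sec(A)$, a vector bundle map $\rho:A\to TM$ over the identity, and a nondegenerate symmetric bilinear form $\langle\cdot,\cdot\rangle$ on $A$ such that, for all sections $X,Y$, $\rho(X)\langle Y,Y\rangle=2\langle X,Y\circ Y\rangle$ and $\rho(X)\langle Y,Y\rangle=2\langle X\circ Y,Y\rangle$. A $(1,1)$-tensor on $A$ is a vector bundle morphism $N:A\to A$ over the identity. $N^*$ is the adjoint of $N$ with respect to the pairing: $\langle NX,Y\rangle=\langle X,N^*Y\rangle$. *)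

theory Defs
  imports "HOL-Analysis.Analysis"
begin

section \<open>Smooth functions on open subsets of R^n\<close>

text \<open>
  R^n is \<open>topspace (Euclidean_space n)\<close>, i.e. the sequences that vanish from index \<open>n\<close> on, so that
  \<open>n\<close> is a number (possibly 0) and not a type. Partial derivatives are derivatives along coordinate
  lines; at points of a set that is open in R^n they depend only on the function on that set.
\<close>

definition partial_deriv :: "nat \<Rightarrow> ((nat \<Rightarrow> real) \<Rightarrow> real) \<Rightarrow> (nat \<Rightarrow> real) \<Rightarrow> real" where
  "partial_deriv i f x = deriv (\<lambda>t. f (x(i := t))) (x i)"

text \<open>\<open>Ck_on n k V f\<close>: all partial derivatives of \<open>f\<close> of order up to \<open>k\<close> exist and are continuous
  on \<open>V\<close>, a set open in R^n.\<close>

primrec Ck_on :: "nat \<Rightarrow> nat \<Rightarrow> (nat \<Rightarrow> real) set \<Rightarrow> ((nat \<Rightarrow> real) \<Rightarrow> real) \<Rightarrow> bool" where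
  "Ck_on n 0 V f \<longleftrightarrow> continuous_on V f"
| "Ck_on n (Suc k) V f \<longleftrightarrow>
     continuous_on V f \<and>
     (\<forall>i<n. (\<forall>x\<in>V. (\<lambda>t. f (x(i := t))) field_differentiable at (x i)) \<and>
            Ck_on n k V (partial_deriv i f))"

definition Cinf_on :: "nat \<Rightarrow> (nat \<Rightarrow> real) set \<Rightarrow> ((nat \<Rightarrow> real) \<Rightarrow> real) \<Rightarrow> bool" where
  "Cinf_on n V f \<longleftrightarrow> (\<forall>k. Ck_on n k V f)"


section \<open>Smooth manifolds\<close>

text \<open>
  The underlying space of a manifold is the whole (Hausdorff, second countable) type \<open>'m\<close>. The atlas
  need not be maximal. A chart is a pair of its domain and its coordinate map.
\<close>

record 'm manifold =
  mfd_dim :: nat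
  charts :: "('m set \<times> ('m \<Rightarrow> nat \<Rightarrow> real)) set"

definition smooth_manifold ::
    "('m::{t2_space,second_countable_topology}, 'z) manifold_scheme \<Rightarrow> bool" where
  "smooth_manifold M \<longleftrightarrow>
     (\<Union>(U, \<phi>)\<in>charts M. U) = UNIV \<and>
     (\<forall>(U, \<phi>)\<in>charts M.
        open U \<and> openin (Euclidean_space (mfd_dim M)) (\<phi> ` U) \<and>
        homeomorphism U (\<phi> ` U) \<phi> (inv_into U \<phi>)) \<and>
     (\<forall>(U, \<phi>)\<in>charts M. \<forall>(V, \<psi>)\<in>charts M. \<forall>i<mfd_dim M.
        Cinf_on (mfd_dim M) (\<phi> ` (U \<inter> V)) (\<lambda>x. \<psi> (inv_into U \<phi> x) i))"

definition smooth_on ::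
    "('m::{t2_space,second_countable_topology}, 'z) manifold_scheme \<Rightarrow> 'm set \<Rightarrow> ('m \<Rightarrow> real) \<Rightarrow> bool"
  where
  "smooth_on M W f \<longleftrightarrow>
     (\<forall>(U, \<phi>)\<in>charts M. Cinf_on (mfd_dim M) (\<phi> ` (U \<inter> W)) (\<lambda>x. f (inv_into U \<phi> x)))"

text \<open>
  Tangent vectors at \<open>p\<close> are the derivations at \<open>p\<close> of the algebra of smooth functions; the value 0 off
  that algebra makes a tangent vector determined by its values on smooth functions.
\<close>

definition tangent_space ::
    "('m::{t2_space,second_countable_topology}, 'z) manifold_scheme \<Rightarrow> 'm \<Rightarrow> (('m \<Rightarrow> real) \<Rightarrow> real) set"
  where
  "tangent_space M p = {D.
     (\<forall>f h. smooth_on M UNIV f \<longrightarrow> smooth_on M UNIV h \<longrightarrow>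
        D (\<lambda>q. f q + h q) = D f + D h \<and>
        D (\<lambda>q. f q * h q) = f p * D h + h p * D f) \<and>
     (\<forall>c f. smooth_on M UNIV f \<longrightarrow> D (\<lambda>q. c * f q) = c * D f) \<and>
     (\<forall>f. \<not> smooth_on M UNIV f \<longrightarrow> D f = 0)}"


section \<open>Smooth vector bundles\<close>

text \<open>
  The fibre over \<open>p\<close> is a linear subspace \<open>fibre A p\<close> of a real vector space \<open>'v\<close>, which serves as a
  mere container: no relation between different fibres is used, and every family of vector spaces is
  isomorphic to one of this form (inside its direct sum). The total space is the disjoint union of
  the fibres, and its smooth structure is given by the local trivializations. A local
  trivialization is a triple of an open set \<open>U\<close>, the rank \<open>r\<close> over \<open>U\<close>, and linear isomorphisms from
  the fibres over \<open>U\<close> to R^r. The rank may differ between components of the base.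
\<close>

record ('m, 'v) vbundle = "'m manifold" +
  fibre :: "'m \<Rightarrow> 'v set"
  trivs :: "('m set \<times> nat \<times> ('m \<Rightarrow> 'v \<Rightarrow> nat \<Rightarrow> real)) set"

definition linear_on_fibre :: "'v::real_vector set \<Rightarrow> ('v \<Rightarrow> real) \<Rightarrow> bool" where
  "linear_on_fibre E f \<longleftrightarrow>
     (\<forall>u\<in>E. \<forall>v\<in>E. f (u + v) = f u + f v) \<and> (\<forall>c. \<forall>u\<in>E. f (c *\<^sub>R u) = c * f u)"

text \<open>The section that corresponds to the \<open>j\<close>-th unit vector under a trivialization.\<close>

definition frame ::
    "('m, 'v, 'z) vbundle_scheme \<Rightarrow> ('m \<Rightarrow> 'v \<Rightarrow> nat \<Rightarrow> real) \<Rightarrow> nat \<Rightarrow> 'm \<Rightarrow> 'v" where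
  "frame A \<Phi> j p = inv_into (fibre A p) (\<Phi> p) (\<lambda>i. if i = j then 1 else 0)"

definition smooth_vbundle ::
    "('m::{t2_space,second_countable_topology}, 'v::real_vector, 'z) vbundle_scheme \<Rightarrow> bool" where
  "smooth_vbundle A \<longleftrightarrow>
     smooth_manifold A \<and>
     (\<forall>p. subspace (fibre A p)) \<and>
     (\<Union>(U, r, \<Phi>)\<in>trivs A. U) = UNIV \<and>
     (\<forall>(U, r, \<Phi>)\<in>trivs A.
        open U \<and>
        (\<forall>p\<in>U. bij_betw (\<Phi> p) (fibre A p) (topspace (Euclidean_space r)) \<and>
               (\<forall>i. linear_on_fibre (fibre A p) (\<lambda>v. \<Phi> p v i)))) \<and>
     (\<forall>(U, r, \<Phi>)\<in>trivs A. \<forall>(V, s, \<Psi>)\<in>trivs A. \<forall>j<r. \<forall>i<s.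
        smooth_on A (U \<inter> V) (\<lambda>p. \<Psi> p (frame A \<Phi> j p) i))"

definition Sec ::
    "('m::{t2_space,second_countable_topology}, 'v::real_vector, 'z) vbundle_scheme \<Rightarrow> ('m \<Rightarrow> 'v) set"
  where
  "Sec A = {X. (\<forall>p. X p \<in> fibre A p) \<and>
     (\<forall>(U, r, \<Phi>)\<in>trivs A. \<forall>i<r. smooth_on A U (\<lambda>p. \<Phi> p (X p) i))}"

text \<open>Vector bundle morphisms over the identity are fibrewise linear maps that are smooth in local
  frames. For a map to the tangent bundle this means that local frame sections are sent to
  smooth vector fields, i.e. to those that map smooth functions to smooth functions.\<close>

definition bundle_endomorphism ::
    "('m::{t2_space,second_countable_topology}, 'v::real_vector, 'z) vbundle_scheme \<Rightarrow>
     ('m \<Rightarrow> 'v \<Rightarrow> 'v) \<Rightarrow> bool" where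
  "bundle_endomorphism A N \<longleftrightarrow>
     (\<forall>p. \<forall>u\<in>fibre A p. N p u \<in> fibre A p) \<and>
     (\<forall>p. \<forall>u\<in>fibre A p. \<forall>v\<in>fibre A p. N p (u + v) = N p u + N p v) \<and>
     (\<forall>p c. \<forall>u\<in>fibre A p. N p (c *\<^sub>R u) = c *\<^sub>R N p u) \<and>
     (\<forall>(U, r, \<Phi>)\<in>trivs A. \<forall>j<r. \<forall>i<r. smooth_on A U (\<lambda>p. \<Phi> p (N p (frame A \<Phi> j p)) i))"

definition bundle_map_to_tangent ::
    "('m::{t2_space,second_countable_topology}, 'v::real_vector, 'z) vbundle_scheme \<Rightarrow>
     ('m \<Rightarrow> 'v \<Rightarrow> ('m \<Rightarrow> real) \<Rightarrow> real) \<Rightarrow> bool" where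
  "bundle_map_to_tangent A \<rho> \<longleftrightarrow>
     (\<forall>p. \<forall>u\<in>fibre A p. \<rho> p u \<in> tangent_space A p) \<and>
     (\<forall>p f. linear_on_fibre (fibre A p) (\<lambda>u. \<rho> p u f)) \<and>
     (\<forall>(U, r, \<Phi>)\<in>trivs A. \<forall>j<r. \<forall>f. smooth_on A UNIV f \<longrightarrow>
        smooth_on A U (\<lambda>p. \<rho> p (frame A \<Phi> j p) f))"

definition bundle_metric ::
    "('m::{t2_space,second_countable_topology}, 'v::real_vector, 'z) vbundle_scheme \<Rightarrow>
     ('m \<Rightarrow> 'v \<Rightarrow> 'v \<Rightarrow> real) \<Rightarrow> bool" where
  "bundle_metric A g \<longleftrightarrow>
     (\<forall>p. \<forall>u\<in>fibre A p. linear_on_fibre (fibre A p) (g p u)) \<and>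
     (\<forall>p. \<forall>u\<in>fibre A p. \<forall>v\<in>fibre A p. g p u v = g p v u) \<and>
     (\<forall>p. \<forall>u\<in>fibre A p. (\<forall>v\<in>fibre A p. g p u v = 0) \<longrightarrow> u = 0) \<and>
     (\<forall>(U, r, \<Phi>)\<in>trivs A. \<forall>i<r. \<forall>j<r.
        smooth_on A U (\<lambda>p. g p (frame A \<Phi> i p) (frame A \<Phi> j p)))"


section \<open>Courant algebroids\<close>

record ('m, 'v) courant = "('m, 'v) vbundle" +
  bracket :: "('m \<Rightarrow> 'v) \<Rightarrow> ('m \<Rightarrow> 'v) \<Rightarrow> 'm \<Rightarrow> 'v"
  anchor :: "'m \<Rightarrow> 'v \<Rightarrow> ('m \<Rightarrow> real) \<Rightarrow> real"
  pairing :: "'m \<Rightarrow> 'v \<Rightarrow> 'v \<Rightarrow> real"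

definition sec_add :: "('m \<Rightarrow> 'v::real_vector) \<Rightarrow> ('m \<Rightarrow> 'v) \<Rightarrow> 'm \<Rightarrow> 'v" where
  "sec_add X Y = (\<lambda>p. X p + Y p)"

definition sec_diff :: "('m \<Rightarrow> 'v::real_vector) \<Rightarrow> ('m \<Rightarrow> 'v) \<Rightarrow> 'm \<Rightarrow> 'v" where
  "sec_diff X Y = (\<lambda>p. X p - Y p)"

definition sec_scale :: "real \<Rightarrow> ('m \<Rightarrow> 'v::real_vector) \<Rightarrow> 'm \<Rightarrow> 'v" where
  "sec_scale c X = (\<lambda>p. c *\<^sub>R X p)"

definition sec_map :: "('m \<Rightarrow> 'v \<Rightarrow> 'v) \<Rightarrow> ('m \<Rightarrow> 'v) \<Rightarrow> 'm \<Rightarrow> 'v" where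
  "sec_map N X = (\<lambda>p. N p (X p))"

definition sec_pair ::
    "('m \<Rightarrow> 'v \<Rightarrow> 'v \<Rightarrow> real) \<Rightarrow> ('m \<Rightarrow> 'v) \<Rightarrow> ('m \<Rightarrow> 'v) \<Rightarrow> 'm \<Rightarrow> real" where
  "sec_pair g X Y = (\<lambda>p. g p (X p) (Y p))"

text \<open>The derivative of the function \<open>f\<close> along the vector field \<open>\<rho>(X)\<close>.\<close>

definition anchor_act ::
    "('m \<Rightarrow> 'v \<Rightarrow> ('m \<Rightarrow> real) \<Rightarrow> real) \<Rightarrow> ('m \<Rightarrow> 'v) \<Rightarrow> ('m \<Rightarrow> real) \<Rightarrow> 'm \<Rightarrow> real" where
  "anchor_act \<rho> X f = (\<lambda>p. \<rho> p (X p) f)"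

definition leibniz_product ::
    "('m \<Rightarrow> 'v::real_vector) set \<Rightarrow> (('m \<Rightarrow> 'v) \<Rightarrow> ('m \<Rightarrow> 'v) \<Rightarrow> 'm \<Rightarrow> 'v) \<Rightarrow> bool" where
  "leibniz_product S b \<longleftrightarrow>
     (\<forall>X\<in>S. \<forall>Y\<in>S. b X Y \<in> S) \<and>
     (\<forall>X\<in>S. \<forall>Y\<in>S. \<forall>Z\<in>S. b (sec_add X Y) Z = sec_add (b X Z) (b Y Z) \<and>
                           b Z (sec_add X Y) = sec_add (b Z X) (b Z Y)) \<and>
     (\<forall>c. \<forall>X\<in>S. \<forall>Y\<in>S. b (sec_scale c X) Y = sec_scale c (b X Y) \<and>
                        b X (sec_scale c Y) = sec_scale c (b X Y)) \<and>
     (\<forall>X\<in>S. \<forall>Y\<in>S. \<forall>Z\<in>S. b (b X Y) Z = sec_diff (b X (b Y Z)) (b Y (b X Z)))"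

definition pairing_compatible ::
    "('m \<Rightarrow> 'v) set \<Rightarrow> (('m \<Rightarrow> 'v) \<Rightarrow> ('m \<Rightarrow> 'v) \<Rightarrow> 'm \<Rightarrow> 'v) \<Rightarrow>
     ('m \<Rightarrow> 'v \<Rightarrow> ('m \<Rightarrow> real) \<Rightarrow> real) \<Rightarrow> ('m \<Rightarrow> 'v \<Rightarrow> 'v \<Rightarrow> real) \<Rightarrow> bool" where
  "pairing_compatible S b \<rho> g \<longleftrightarrow>
     (\<forall>X\<in>S. \<forall>Y\<in>S.
        anchor_act \<rho> X (sec_pair g Y Y) = (\<lambda>p. 2 * sec_pair g X (b Y Y) p) \<and>
        anchor_act \<rho> X (sec_pair g Y Y) = (\<lambda>p. 2 * sec_pair g (b X Y) Y p))"

definition courant_algebroid ::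
    "('m::{t2_space,second_countable_topology}, 'v::real_vector, 'z) courant_scheme \<Rightarrow> bool" where
  "courant_algebroid A \<longleftrightarrow>
     smooth_vbundle A \<and>
     leibniz_product (Sec A) (bracket A) \<and>
     bundle_map_to_tangent A (anchor A) \<and>
     bundle_metric A (pairing A) \<and>
     pairing_compatible (Sec A) (bracket A) (anchor A) (pairing A)"

definition adjoint_tensor ::
    "('m, 'v, 'z) courant_scheme \<Rightarrow> ('m \<Rightarrow> 'v \<Rightarrow> 'v) \<Rightarrow> 'm \<Rightarrow> 'v \<Rightarrow> 'v" where
  "adjoint_tensor A N p v =
     (THE w. w \<in> fibre A p \<and> (\<forall>u\<in>fibre A p. pairing A p (N p u) v = pairing A p u w))"

definition tensor_add ::
    "('m \<Rightarrow> 'v::real_vector \<Rightarrow> 'v) \<Rightarrow> ('m \<Rightarrow> 'v \<Rightarrow> 'v) \<Rightarrow> 'm \<Rightarrow> 'v \<Rightarrow> 'v" where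
  "tensor_add N K p v = N p v + K p v"

definition contracted_bracket ::
    "('m, 'v::real_vector, 'z) courant_scheme \<Rightarrow> ('m \<Rightarrow> 'v \<Rightarrow> 'v) \<Rightarrow>
     ('m \<Rightarrow> 'v) \<Rightarrow> ('m \<Rightarrow> 'v) \<Rightarrow> 'm \<Rightarrow> 'v" where
  "contracted_bracket A N X Y =
     sec_diff (sec_add (bracket A (sec_map N X) Y) (bracket A X (sec_map N Y)))
       (sec_map N (bracket A X Y))"

definition contracted_anchor ::
    "('m, 'v, 'z) courant_scheme \<Rightarrow> ('m \<Rightarrow> 'v \<Rightarrow> 'v) \<Rightarrow> 'm \<Rightarrow> 'v \<Rightarrow> ('m \<Rightarrow> real) \<Rightarrow> real" where
  "contracted_anchor A N p = anchor A p \<circ> N p"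

end

theory Submission
  imports Defs "Jordan_Normal_Form.Determinant"
begin

text \<open>
  Put \<open>S = N + N\<^sup>*\<close>, a self-adjoint operator on sections with \<open>\<langle>SY, Y\<rangle> = 2\<langle>NY, Y\<rangle>\<close>. Polarizing the two
  axioms of a Courant algebroid gives
  \<open>\<rho>(X)\<langle>Y, Z\<rangle> = \<langle>X, Y \<circ> Z + Z \<circ> Y\<rangle> = \<langle>X \<circ> Y, Z\<rangle> + \<langle>X \<circ> Z, Y\<rangle>\<close> (lemma \<open>act_pair\<close>).
  Evaluating \<open>\<rho>(X)\<langle>SY, Y\<rangle> = 2\<rho>(X)\<langle>NY, Y\<rangle>\<close> by either formula removes \<open>N\<close> from the
  compatibility conditions and leaves \<open>S\<close> alone:

  \<^item> the first condition becomes \<open>2\<langle>X, S(Y \<circ> Y)\<rangle> = \<langle>X, SY \<circ> Y + Y \<circ> SY\<rangle>\<close>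
    (\<open>first_compatibility_iff\<close>);
  \<^item> the second becomes \<open>\<langle>X \<circ> SY - S(X \<circ> Y), Y\<rangle> = 0\<close> (\<open>second_compatibility_iff\<close>).

  The form \<open>(Y, Z) \<mapsto> \<langle>X \<circ> SY - S(X \<circ> Y), Z\<rangle>\<close> is symmetric, because \<open>X \<circ>\<close> differentiates the pairing
  and \<open>S\<close> is self-adjoint (\<open>commutator_form_sym\<close>). A symmetric form that vanishes on the diagonal
  is zero, so the second condition says that \<open>S\<close> commutes with every \<open>X \<circ>\<close>. In the presence of this the
  first condition reduces to \<open>S(Y \<circ> Y) = SY \<circ> Y\<close>.

  This computation takes place in the space of smooth sections, and three facts of analysis put it
  there. The function \<open>\<langle>Y, Z\<rangle>\<close> is smooth, so that the derivation \<open>\<rho>(X)\<close> is additive on such functions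
  and polarization is legitimate (\<open>smooth_on_metric\<close>). The adjoint of \<open>N\<close> exists and maps
  smooth sections to smooth sections: in a local frame it is found by solving a linear system whose
  matrix is the Gram matrix of the pairing, and Cramer's rule shows that the solution depends smoothly on
  the point (\<open>local_adjoint\<close>). Finally, every vector of a fibre is the value of a global smooth
  section, by means of a bump function (\<open>exists_section_through\<close>), so a section is determined by
  its pairings with sections (\<open>sections_eq_if_pairings_eq\<close>).
\<close>


section \<open>Calculus of partial derivatives on open subsets of R^n\<close>

lemma eventually_coordinate_line_in:
  assumes "openin (Euclidean_space n) V" "x \<in> V" "i < n"
  shows "\<forall>\<^sub>F t in nhds (x i). x(i := t) \<in> V"
proof -
  obtain T where T: "open T" "V = T \<inter> topspace (Euclidean_space n)"
    using assms(1) by (auto simp: Euclidean_space_def openin_subtopology euclidean_product_topology)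
  have "continuous_on UNIV (\<lambda>t::real. x(i := t))"
  proof (rule continuous_on_coordinatewise_then_product)
    show "continuous_on UNIV (\<lambda>t. (x(i := t)) j)" for j
      by (cases "j = i") auto
  qed
  then have "open ((\<lambda>t. x(i := t)) -` T)"
    using T(1) open_vimage by blast
  then have "\<forall>\<^sub>F t in nhds (x i). t \<in> (\<lambda>t. x(i := t)) -` T"
    by (rule eventually_nhds_in_open) (use T assms(2) in auto)
  then show ?thesis
    by eventually_elim (use T assms(2,3) in \<open>auto simp: topspace_Euclidean_space\<close>)
qed

lemma Ck_on_imp_continuous: "Ck_on n k V f \<Longrightarrow> continuous_on V f"
  by (cases k) auto

lemma Ck_on_Suc_has_derivative:
  assumes "Ck_on n (Suc k) V f" "i < n" "x \<in> V"
  shows "((\<lambda>t. f (x(i := t))) has_real_derivative partial_deriv i f x) (at (x i))"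
  using assms unfolding partial_deriv_def
  by (simp add: field_differentiable_derivI)

text \<open>
  A partial derivative at a point of \<open>V\<close> depends only on the values on a short coordinate segment,
  which lies in \<open>V\<close> because \<open>V\<close> is open in R^n.
\<close>

lemma Ck_on_cong:
  assumes "openin (Euclidean_space n) V" "\<And>x. x \<in> V \<Longrightarrow> f x = g x"
  shows "Ck_on n k V f \<longleftrightarrow> Ck_on n k V g"
  using assms(2)
proof (induction k arbitrary: f g)
  case 0
  then show ?case by (simp cong: continuous_on_cong)
next
  case (Suc k)
  have ev: "\<forall>\<^sub>F t in nhds (x i). f (x(i := t)) = g (x(i := t))" if "x \<in> V" "i < n" for x i
    using eventually_coordinate_line_in[OF assms(1) that]
    by eventually_elim (rule Suc.prems)
  have "partial_deriv i f x = partial_deriv i g x" if "x \<in> V" "i < n" for x i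
    unfolding partial_deriv_def using ev[OF that] by (rule deriv_cong_ev) simp
  then have "Ck_on n k V (partial_deriv i f) \<longleftrightarrow> Ck_on n k V (partial_deriv i g)" if "i < n" for i
    using Suc.IH that by blast
  moreover have "(\<lambda>t. f (x(i := t))) field_differentiable at (x i) \<longleftrightarrow>
      (\<lambda>t. g (x(i := t))) field_differentiable at (x i)" if "x \<in> V" "i < n" for x i
    unfolding field_differentiable_def using DERIV_cong_ev[OF refl ev[OF that] refl] by simp
  moreover have "continuous_on V f \<longleftrightarrow> continuous_on V g"
    using Suc.prems by (simp cong: continuous_on_cong)
  ultimately show ?case by auto
qed

text \<open>
  The form in which composite expressions are differentiated: the formula \<open>D i\<close> equals the partial derivative
  on \<open>V\<close> and may differ from it elsewhere.
\<close>

lemma Ck_on_SucI: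
  assumes "openin (Euclidean_space n) V" "continuous_on V f"
    and D: "\<And>i x. i < n \<Longrightarrow> x \<in> V \<Longrightarrow> ((\<lambda>t. f (x(i := t))) has_real_derivative D i x) (at (x i))"
    and "\<And>i. i < n \<Longrightarrow> Ck_on n k V (D i)"
  shows "Ck_on n (Suc k) V f"
proof -
  have "partial_deriv i f x = D i x" if "i < n" "x \<in> V" for i x
    unfolding partial_deriv_def using D[OF that] by (rule DERIV_imp_deriv)
  then have "Ck_on n k V (partial_deriv i f)" if "i < n" for i
    using Ck_on_cong[OF assms(1)] assms(4) that by blast
  then show ?thesis
    using assms(2) D by (auto simp: field_differentiable_def)
qed

lemma Ck_on_pred: "Ck_on n (Suc k) V f \<Longrightarrow> Ck_on n k V f"
  by (induction k arbitrary: f) auto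

lemma Ck_on_const:
  assumes "openin (Euclidean_space n) V"
  shows "Ck_on n k V (\<lambda>_. c)"
proof (induction k arbitrary: c)
  case (Suc k)
  show ?case
    by (rule Ck_on_SucI[OF assms, where D = "\<lambda>_ _. 0"]) (auto intro: Suc)
qed simp

lemma Ck_on_add:
  assumes "openin (Euclidean_space n) V" "Ck_on n k V f" "Ck_on n k V g"
  shows "Ck_on n k V (\<lambda>x. f x + g x)"
  using assms(2,3)
proof (induction k arbitrary: f g)
  case 0
  then show ?case by (auto intro: continuous_on_add)
next
  case (Suc k)
  show ?case
  proof (rule Ck_on_SucI[OF assms(1), where D = "\<lambda>i x. partial_deriv i f x + partial_deriv i g x"])
    show "continuous_on V (\<lambda>x. f x + g x)"
      using Suc.prems by (auto intro: continuous_on_add)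
    show "((\<lambda>t. f (x(i := t)) + g (x(i := t))) has_real_derivative
        partial_deriv i f x + partial_deriv i g x) (at (x i))" if "i < n" "x \<in> V" for i x
      by (intro DERIV_add Ck_on_Suc_has_derivative[OF Suc.prems(1) that]
          Ck_on_Suc_has_derivative[OF Suc.prems(2) that])
  qed (use Suc in auto)
qed

lemma Ck_on_mult:
  assumes "openin (Euclidean_space n) V" "Ck_on n k V f" "Ck_on n k V g"
  shows "Ck_on n k V (\<lambda>x. f x * g x)"
  using assms(2,3)
proof (induction k arbitrary: f g)
  case 0
  then show ?case by (auto intro: continuous_on_mult)
next
  case (Suc k)
  show ?case
  proof (rule Ck_on_SucI[OF assms(1),
        where D = "\<lambda>i x. partial_deriv i f x * g x + partial_deriv i g x * f x"])
    show "continuous_on V (\<lambda>x. f x * g x)"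
      using Suc.prems by (auto intro: continuous_on_mult)
    show "((\<lambda>t. f (x(i := t)) * g (x(i := t))) has_real_derivative
        partial_deriv i f x * g x + partial_deriv i g x * f x) (at (x i))" if "i < n" "x \<in> V" for i x
      using DERIV_mult[OF Ck_on_Suc_has_derivative[OF Suc.prems(1) that]
          Ck_on_Suc_has_derivative[OF Suc.prems(2) that]] by (simp only: fun_upd_triv)
    show "Ck_on n k V (\<lambda>x. partial_deriv i f x * g x + partial_deriv i g x * f x)" if "i < n" for i
      using Suc.prems that
      by (intro Ck_on_add[OF assms(1)] Suc.IH) (auto intro: Ck_on_pred[unfolded Ck_on.simps])
  qed
qed

text \<open>
  The chain rule for an outer function of one variable. Placing that function in a family closed under
  differentiation lets the induction run on the first derivative, with no formula for the higher derivatives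
  of a composition.
\<close>

lemma Ck_on_compose_real:
  assumes V: "openin (Euclidean_space n) V"
    and H: "\<And>h. h \<in> H \<Longrightarrow> \<exists>h'\<in>H. \<forall>t\<in>S. (h has_real_derivative h' t) (at t)"
    and f: "Ck_on n k V f" "\<And>x. x \<in> V \<Longrightarrow> f x \<in> S"
    and h: "h \<in> H"
  shows "Ck_on n k V (\<lambda>x. h (f x))"
  using f(1) h
proof (induction k arbitrary: h)
  case 0
  then obtain h' where "\<forall>t\<in>S. (h has_real_derivative h' t) (at t)"
    using H by blast
  then have "continuous_on S h"
    by (meson DERIV_isCont continuous_at_imp_continuous_on)
  then show ?case
    using 0 f(2) by (auto intro: continuous_on_compose2)
next
  case (Suc k)
  obtain h' where h': "h' \<in> H" "\<And>t. t \<in> S \<Longrightarrow> (h has_real_derivative h' t) (at t)"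
    using H Suc.prems(2) by blast
  have "continuous_on S h"
    using h'(2) by (meson DERIV_isCont continuous_at_imp_continuous_on)
  show ?case
  proof (rule Ck_on_SucI[OF V, where D = "\<lambda>i x. h' (f x) * partial_deriv i f x"])
    show "continuous_on V (\<lambda>x. h (f x))"
      using Suc.prems f(2) \<open>continuous_on S h\<close> by (auto intro: continuous_on_compose2)
    show "((\<lambda>t. h (f (x(i := t)))) has_real_derivative h' (f x) * partial_deriv i f x) (at (x i))"
      if "i < n" "x \<in> V" for i x
    proof (rule DERIV_chain2[of h])
      show "(h has_real_derivative h' (f x)) (at (f (x(i := x i))))"
        using h'(2)[OF f(2)[OF that(2)]] by (simp only: fun_upd_triv)
    qed (rule Ck_on_Suc_has_derivative[OF Suc.prems(1) that])
    show "Ck_on n k V (\<lambda>x. h' (f x) * partial_deriv i f x)" if "i < n" for i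
      using Suc.prems(1) that Suc.IH[OF Ck_on_pred[OF Suc.prems(1)] h'(1)]
      by (intro Ck_on_mult[OF V]) auto
  qed
qed

text \<open>
  Smoothness is a local property; this is what allows functions to be glued from pieces.
\<close>

lemma Ck_on_local:
  assumes V: "openin (Euclidean_space n) V"
    and "\<And>x. x \<in> V \<Longrightarrow> \<exists>W. openin (Euclidean_space n) W \<and> x \<in> W \<and> Ck_on n k W f"
  shows "Ck_on n k V f"
  using assms(2)
proof (induction k arbitrary: f)
  case 0
  have "continuous (at x within V) f" if x: "x \<in> V" for x
  proof -
    obtain W where W: "openin (Euclidean_space n) W" "x \<in> W" "continuous_on W f"
      using 0 x by auto
    obtain T where T: "open T" "W = T \<inter> topspace (Euclidean_space n)"
      using W(1) by (auto simp: Euclidean_space_def openin_subtopology euclidean_product_topology)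
    have "V \<inter> T \<subseteq> W" using openin_subset[OF V] T by blast
    then have "continuous (at x within (V \<inter> T)) f"
      using W x T continuous_on_subset continuous_on_eq_continuous_within by blast
    moreover have "at x within (V \<inter> T) = at x within V"
      by (rule at_within_nhd[of x T]) (use x T W in auto)
    ultimately show ?thesis by simp
  qed
  then show ?case by (simp add: continuous_on_eq_continuous_within)
next
  case (Suc k)
  have "Ck_on n k V f"
    by (rule Suc.IH) (meson Suc.prems Ck_on_pred)
  then have "continuous_on V f" by (rule Ck_on_imp_continuous)
  moreover have "(\<lambda>t. f (x(i := t))) field_differentiable at (x i)" if "x \<in> V" "i < n" for x i
    using Suc.prems[OF that(1)] that(2) by auto
  moreover have "Ck_on n k V (partial_deriv i f)" if "i < n" for i
    by (rule Suc.IH) (use Suc.prems that in fastforce)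
  ultimately show ?case by auto
qed

lemma Ck_on_subset: "Ck_on n k V f \<Longrightarrow> W \<subseteq> V \<Longrightarrow> Ck_on n k W f"
  by (induction k arbitrary: f) (auto intro: continuous_on_subset)


section \<open>Smooth functions of one variable as outer functions\<close>

text \<open>
  For \<open>p = 1\<close> this is the standard smooth function that vanishes exactly on the half-line \<open>t \<le> 0\<close>. The
  polynomial factor makes the family closed under differentiation.
\<close>

definition flat :: "real poly \<Rightarrow> real \<Rightarrow> real" where
  "flat p t = (if t > 0 then poly p (1 / t) * exp (- (1 / t)) else 0)"

lemma poly_times_exp_uminus_tendsto_0: "((\<lambda>s::real. poly p s * exp (- s)) \<longlongrightarrow> 0) at_top"
proof -
  have "((\<lambda>s. \<Sum>i\<le>degree p. coeff p i * (s ^ i / exp s)) \<longlongrightarrow> (\<Sum>i\<le>degree p. coeff p i * 0)) at_top"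
    by (intro tendsto_sum tendsto_mult tendsto_const tendsto_power_div_exp_0)
  then show ?thesis
    by (simp add: poly_altdef sum_distrib_right exp_minus divide_inverse mult.assoc)
qed

text \<open>
  Away from 0 this is the usual calculation. At 0 the difference quotient from the right is a polynomial
  in \<open>1 / t\<close> times \<open>exp (- 1 / t)\<close>, which tends to 0.
\<close>

lemma flat_has_derivative:
  "(flat p has_real_derivative flat ([:0, 0, 1:] * (p - pderiv p)) t) (at t)"
proof -
  consider "t > 0" | "t < 0" | "t = 0" by linarith
  then show ?thesis
  proof cases
    case 1
    have ev: "\<forall>\<^sub>F s in nhds t. flat p s = poly p (1 / s) * exp (- (1 / s))"
      using eventually_nhds_in_open[of "{0<..}" t] 1
      by (auto elim!: eventually_mono simp: flat_def)
    have "((\<lambda>s. poly p (1 / s) * exp (- (1 / s))) has_real_derivative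
        flat ([:0, 0, 1:] * (p - pderiv p)) t) (at t)"
      using 1 by (auto intro!: derivative_eq_intros DERIV_chain2[OF poly_DERIV] simp: flat_def field_simps power2_eq_square)
    then show ?thesis using DERIV_cong_ev[OF refl ev refl] by blast
  next
    case 2
    have ev: "\<forall>\<^sub>F s in nhds t. flat p s = 0"
      using eventually_nhds_in_open[of "{..<0}" t] 2
      by (auto elim!: eventually_mono simp: flat_def)
    have "(flat p has_real_derivative 0) (at t)"
      using DERIV_cong_ev[OF refl ev refl, of 0] by simp
    then show ?thesis using 2 by (simp add: flat_def)
  next
    case 3
    have "((\<lambda>s. poly (pCons 0 p) (inverse s) * exp (- inverse s)) \<longlongrightarrow> 0) (at_right 0)"
      by (rule filterlim_compose[OF poly_times_exp_uminus_tendsto_0 filterlim_inverse_at_top_right])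
    moreover have "\<forall>\<^sub>F s in at_right 0.
        poly (pCons 0 p) (inverse s) * exp (- inverse s) = (flat p (0 + s) - flat p 0) / s"
      by (auto simp: eventually_at_filter flat_def divide_inverse)
    ultimately have "((\<lambda>s. (flat p (0 + s) - flat p 0) / s) \<longlongrightarrow> 0) (at_right 0)"
      by (rule Lim_transform_eventually)
    moreover have "\<forall>\<^sub>F s in at_left 0. 0 = (flat p (0 + s) - flat p 0) / s"
      by (auto simp: eventually_at_filter flat_def)
    then have "((\<lambda>s. (flat p (0 + s) - flat p 0) / s) \<longlongrightarrow> 0) (at_left 0)"
      by (rule Lim_transform_eventually[OF tendsto_const])
    ultimately show ?thesis
      using 3 by (simp add: DERIV_def filterlim_at_split flat_def)
  qed
qed

lemma Cinf_on_flat_compose: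
  assumes "openin (Euclidean_space n) V" "Cinf_on n V f"
  shows "Cinf_on n V (\<lambda>x. flat p (f x))"
  unfolding Cinf_on_def
proof
  fix k
  show "Ck_on n k V (\<lambda>x. flat p (f x))"
    by (rule Ck_on_compose_real[where H = "range flat" and S = UNIV and h = "flat p" and f = f, OF assms(1)])
      (use assms(2) flat_has_derivative in \<open>auto simp: Cinf_on_def\<close>)
qed

lemma Cinf_on_inverse:
  assumes "openin (Euclidean_space n) V" "Cinf_on n V f" "\<And>x. x \<in> V \<Longrightarrow> f x \<noteq> 0"
  shows "Cinf_on n V (\<lambda>x. inverse (f x))"
  unfolding Cinf_on_def
proof
  fix k
  \<comment> \<open>The family of all \<open>c / t ^ m\<close> contains the derivatives of its members.\<close>
  let ?H = "range (\<lambda>(c :: real, m :: nat) t. c * inverse t ^ m)"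
  show "Ck_on n k V (\<lambda>x. inverse (f x))"
  proof (rule Ck_on_compose_real[where H = ?H and S = "-{0}" and h = inverse and f = f, OF assms(1)])
    fix h assume "h \<in> ?H"
    then obtain c m where h: "h = (\<lambda>t. c * inverse t ^ m)" by auto
    have "(h has_real_derivative (- c * real m) * inverse t ^ (m + 1)) (at t)" if "t \<noteq> 0" for t
    proof -
      have "(h has_real_derivative
          c * (real m * (- (inverse t ^ Suc (Suc 0)) * inverse t ^ (m - Suc 0)))) (at t)"
        unfolding h by (intro DERIV_cmult DERIV_power DERIV_inverse that)
      moreover have "c * (real m * (- (inverse t ^ Suc (Suc 0)) * inverse t ^ (m - Suc 0)))
          = (- c * real m) * inverse t ^ (m + 1)"
        by (cases m) (simp_all only: power_Suc power_0 of_nat_0 Suc_eq_plus1[symmetric] diff_Suc_Suc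
            diff_zero mult_zero_left mult_zero_right mult_minus_left mult_minus_right mult_1_right mult_ac)
      ultimately show ?thesis by (simp only:)
    qed
    moreover have "(\<lambda>t. (- c * real m) * inverse t ^ (m + 1)) \<in> ?H"
      by (rule range_eqI[where x = "(- c * real m, m + 1)"]) simp
    ultimately show "\<exists>h'\<in>?H. \<forall>t\<in>-{0}. (h has_real_derivative h' t) (at t)"
      by (intro bexI[of _ "\<lambda>t. (- c * real m) * inverse t ^ (m + 1)"] ballI) (blast, assumption)
  next
    show "inverse \<in> ?H" by (rule range_eqI[where x = "(1, 1)"]) auto
  qed (use assms in \<open>auto simp: Cinf_on_def\<close>)
qed

lemma Cinf_on_const: "openin (Euclidean_space n) V \<Longrightarrow> Cinf_on n V (\<lambda>_. c)"
  by (simp add: Cinf_on_def Ck_on_const)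

lemma Cinf_on_add:
  "openin (Euclidean_space n) V \<Longrightarrow> Cinf_on n V f \<Longrightarrow> Cinf_on n V g \<Longrightarrow> Cinf_on n V (\<lambda>x. f x + g x)"
  by (simp add: Cinf_on_def Ck_on_add)

lemma Cinf_on_mult:
  "openin (Euclidean_space n) V \<Longrightarrow> Cinf_on n V f \<Longrightarrow> Cinf_on n V g \<Longrightarrow> Cinf_on n V (\<lambda>x. f x * g x)"
  by (simp add: Cinf_on_def Ck_on_mult)


section \<open>Smooth functions on a manifold\<close>

lemma smooth_manifold_chart:
  assumes "smooth_manifold M" "(U, \<phi>) \<in> charts M"
  shows "open U" "openin (Euclidean_space (mfd_dim M)) (\<phi> ` U)"
    "homeomorphism U (\<phi> ` U) \<phi> (inv_into U \<phi>)"
    "\<And>q. q \<in> U \<Longrightarrow> inv_into U \<phi> (\<phi> q) = q"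
  using assms by (auto simp: smooth_manifold_def homeomorphism_def)

lemma chart_image_open:
  assumes "smooth_manifold M" "(U, \<phi>) \<in> charts M" "open W"
  shows "openin (Euclidean_space (mfd_dim M)) (\<phi> ` (U \<inter> W))"
proof -
  note c = smooth_manifold_chart[OF assms(1,2)]
  have "openin (top_of_set (\<phi> ` U)) (\<phi> ` (U \<inter> W))"
    by (rule homeomorphism_imp_open_map[OF c(3)]) (use assms(3) in auto)
  moreover have "top_of_set (\<phi> ` U) = subtopology (Euclidean_space (mfd_dim M)) (\<phi> ` U)"
    using openin_subset[OF c(2)]
    by (simp add: Euclidean_space_def subtopology_subtopology euclidean_product_topology
        topspace_Euclidean_space[unfolded Euclidean_space_def] Int_absorb1)
  ultimately show ?thesis
    using c(2) by (simp add: openin_trans_full)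
qed

lemma smooth_onI:
  assumes "\<And>U \<phi>. (U, \<phi>) \<in> charts M \<Longrightarrow>
    Cinf_on (mfd_dim M) (\<phi> ` (U \<inter> W)) (\<lambda>x. f (inv_into U \<phi> x))"
  shows "smooth_on M W f"
  using assms by (auto simp: smooth_on_def)

lemma smooth_onD:
  assumes "smooth_on M W f" "(U, \<phi>) \<in> charts M"
  shows "Cinf_on (mfd_dim M) (\<phi> ` (U \<inter> W)) (\<lambda>x. f (inv_into U \<phi> x))"
  using assms by (auto simp: smooth_on_def)

lemma smooth_on_cong_imp:
  assumes M: "smooth_manifold M" and "open W" "\<And>q. q \<in> W \<Longrightarrow> f q = g q" "smooth_on M W g"
  shows "smooth_on M W f"
proof (rule smooth_onI)
  fix U \<phi> assume ch: "(U, \<phi>) \<in> charts M"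
  have "f (inv_into U \<phi> x) = g (inv_into U \<phi> x)" if "x \<in> \<phi> ` (U \<inter> W)" for x
    using that smooth_manifold_chart(4)[OF M ch] assms(3) by force
  then show "Cinf_on (mfd_dim M) (\<phi> ` (U \<inter> W)) (\<lambda>x. f (inv_into U \<phi> x))"
    using smooth_onD[OF assms(4) ch] Ck_on_cong[OF chart_image_open[OF M ch assms(2)],
        of "\<lambda>x. f (inv_into U \<phi> x)" "\<lambda>x. g (inv_into U \<phi> x)"]
    unfolding Cinf_on_def by blast
qed

lemma smooth_on_subset:
  assumes "smooth_on M W f" "W' \<subseteq> W"
  shows "smooth_on M W' f"
proof (rule smooth_onI)
  fix U \<phi> assume "(U, \<phi>) \<in> charts M"
  moreover have "\<phi> ` (U \<inter> W') \<subseteq> \<phi> ` (U \<inter> W)" using assms(2) by blast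
  ultimately show "Cinf_on (mfd_dim M) (\<phi> ` (U \<inter> W')) (\<lambda>x. f (inv_into U \<phi> x))"
    using smooth_onD[OF assms(1)] unfolding Cinf_on_def by (meson Ck_on_subset)
qed

lemma smooth_on_local:
  assumes "smooth_manifold M" "open W"
    and loc: "\<And>p. p \<in> W \<Longrightarrow> \<exists>W'. open W' \<and> p \<in> W' \<and> smooth_on M W' f"
  shows "smooth_on M W f"
  unfolding smooth_on_def Cinf_on_def
proof (safe)
  fix U \<phi> k assume ch: "(U, \<phi>) \<in> charts M"
  show "Ck_on (mfd_dim M) k (\<phi> ` (U \<inter> W)) (\<lambda>x. f (inv_into U \<phi> x))"
  proof (rule Ck_on_local[OF chart_image_open[OF assms(1) ch assms(2)]])
    fix x assume "x \<in> \<phi> ` (U \<inter> W)"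
    then obtain p where p: "p \<in> U" "p \<in> W" "x = \<phi> p" by blast
    obtain W' where W': "open W'" "p \<in> W'" "smooth_on M W' f" using loc[OF p(2)] by blast
    show "\<exists>V. openin (Euclidean_space (mfd_dim M)) V \<and> x \<in> V \<and>
        Ck_on (mfd_dim M) k V (\<lambda>x. f (inv_into U \<phi> x))"
      using chart_image_open[OF assms(1) ch W'(1)] p W'(2,3) ch
      by (intro exI[of _ "\<phi> ` (U \<inter> W')"]) (auto simp: smooth_on_def Cinf_on_def)
  qed
qed

text \<open>
  This is the compatibility of charts, read as a statement about one coordinate function.
\<close>

lemma smooth_on_coordinate:
  assumes "smooth_manifold M" "(U, \<phi>) \<in> charts M" "i < mfd_dim M"
  shows "smooth_on M U (\<lambda>q. \<phi> q i)"
proof (rule smooth_onI)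
  fix V \<psi> assume V: "(V, \<psi>) \<in> charts M"
  have "\<forall>c\<in>charts M. \<forall>d\<in>charts M. \<forall>i<mfd_dim M. Cinf_on (mfd_dim M) (snd c ` (fst c \<inter> fst d))
      (\<lambda>x. snd d (inv_into (fst c) (snd c) x) i)"
    using assms(1) unfolding smooth_manifold_def case_prod_beta by blast
  from bspec[OF bspec[OF this V] assms(2)]
  show "Cinf_on (mfd_dim M) (\<psi> ` (V \<inter> U)) (\<lambda>x. \<phi> (inv_into V \<psi> x) i)"
    using assms(3) by simp
qed

context
  fixes M :: "('m::{t2_space,second_countable_topology}, 'z) manifold_scheme" and W :: "'m set"
  assumes M: "smooth_manifold M" and W: "open W"
begin

lemma smooth_on_const: "smooth_on M W (\<lambda>_. c)"
  by (rule smooth_onI) (rule Cinf_on_const[OF chart_image_open[OF M _ W]])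

lemma smooth_on_add:
  "smooth_on M W f \<Longrightarrow> smooth_on M W g \<Longrightarrow> smooth_on M W (\<lambda>p. f p + g p)"
  by (rule smooth_onI) (intro Cinf_on_add[OF chart_image_open[OF M _ W]] smooth_onD)

lemma smooth_on_mult:
  "smooth_on M W f \<Longrightarrow> smooth_on M W g \<Longrightarrow> smooth_on M W (\<lambda>p. f p * g p)"
  by (rule smooth_onI) (intro Cinf_on_mult[OF chart_image_open[OF M _ W]] smooth_onD)

lemma smooth_on_flat: "smooth_on M W f \<Longrightarrow> smooth_on M W (\<lambda>p. flat u (f p))"
  by (rule smooth_onI) (intro Cinf_on_flat_compose[OF chart_image_open[OF M _ W]] smooth_onD)

lemma smooth_on_inverse:
  assumes "smooth_on M W f" "\<And>p. p \<in> W \<Longrightarrow> f p \<noteq> 0"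
  shows "smooth_on M W (\<lambda>p. inverse (f p))"
proof (rule smooth_onI)
  fix U \<phi> assume ch: "(U, \<phi>) \<in> charts M"
  show "Cinf_on (mfd_dim M) (\<phi> ` (U \<inter> W)) (\<lambda>x. inverse (f (inv_into U \<phi> x)))"
  proof (rule Cinf_on_inverse[OF chart_image_open[OF M ch W] smooth_onD[OF assms(1) ch]])
    show "f (inv_into U \<phi> x) \<noteq> 0" if "x \<in> \<phi> ` (U \<inter> W)" for x
      using that smooth_manifold_chart(4)[OF M ch] assms(2) by force
  qed
qed

lemma smooth_on_diff:
  "smooth_on M W f \<Longrightarrow> smooth_on M W g \<Longrightarrow> smooth_on M W (\<lambda>p. f p - g p)"
  using smooth_on_add[OF _ smooth_on_mult[OF smooth_on_const[of "-1"]], of f g] by simp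

lemma smooth_on_sum:
  "(\<And>i. i \<in> I \<Longrightarrow> smooth_on M W (f i)) \<Longrightarrow> smooth_on M W (\<lambda>p. \<Sum>i\<in>I. f i p)"
  by (induction I rule: infinite_finite_induct) (auto intro: smooth_on_const smooth_on_add)

lemma smooth_on_prod:
  "(\<And>i. i \<in> I \<Longrightarrow> smooth_on M W (f i)) \<Longrightarrow> smooth_on M W (\<lambda>p. \<Prod>i\<in>I. f i p)"
  by (induction I rule: infinite_finite_induct) (auto intro: smooth_on_const smooth_on_mult)

end


section \<open>Bump functions\<close>

text \<open>
  A product of compact intervals, with all but finitely many of them reduced to a point.
\<close>

lemma compact_coordinate_box:
  "compact {x. (\<forall>i<n::nat. \<bar>x i - a i\<bar> \<le> (e :: real)) \<and> (\<forall>i\<ge>n. x i = 0)}"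
proof -
  let ?I = "\<lambda>i. if i < n then {a i - e..a i + e} else {0}"
  have "((\<forall>i<n. \<bar>x i - a i\<bar> \<le> e) \<and> (\<forall>i\<ge>n. x i = 0)) \<longleftrightarrow> (\<forall>i. x i \<in> ?I i)" for x
  proof -
    have "x i \<in> ?I i \<longleftrightarrow> (i < n \<longrightarrow> \<bar>x i - a i\<bar> \<le> e) \<and> (n \<le> i \<longrightarrow> x i = 0)" for i
    proof (cases "i < n")
      case True
      have "x i \<in> {a i - e..a i + e} \<longleftrightarrow> \<bar>x i - a i\<bar> \<le> e"
        unfolding atLeastAtMost_iff by linarith
      then show ?thesis using True by auto
    qed simp
    then show ?thesis by blast
  qed
  then have "{x. (\<forall>i<n. \<bar>x i - a i\<bar> \<le> e) \<and> (\<forall>i\<ge>n. x i = 0)} = Pi\<^sub>E UNIV ?I"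
    by (simp add: PiE_UNIV_domain Pi_def)
  moreover have "compactin (product_topology (\<lambda>i. euclideanreal) UNIV) (Pi\<^sub>E UNIV ?I)"
    by (subst compactin_PiE) auto
  ultimately show ?thesis by (simp add: euclidean_product_topology)
qed

lemma coordinate_box_subset_open:
  assumes "openin (Euclidean_space n) V" "a \<in> V"
  obtains e where "e > 0" "{x. (\<forall>i<n. \<bar>x i - a i\<bar> \<le> e) \<and> (\<forall>i\<ge>n. x i = 0)} \<subseteq> V"
proof -
  obtain T where T: "openin (product_topology (\<lambda>i. euclideanreal) UNIV) T"
    "V = T \<inter> topspace (Euclidean_space n)"
    using assms(1) by (auto simp: Euclidean_space_def openin_subtopology)
  then obtain X where X: "finite {i. X i \<noteq> topspace euclideanreal}" "\<And>i. open (X i)"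
      "a \<in> Pi\<^sub>E UNIV X" "Pi\<^sub>E UNIV X \<subseteq> T"
    using assms(2) unfolding openin_product_topology_alt by fastforce
  have "\<exists>e>0. cball (a i) e \<subseteq> X i" for i
    using X(2,3) open_contains_cball by (metis PiE_mem UNIV_I)
  then obtain e where e: "\<And>i. e i > 0" "\<And>i. cball (a i) (e i) \<subseteq> X i" by metis
  \<comment> \<open>Inserting 1 keeps the set nonempty when \<open>n = 0\<close>.\<close>
  define d where "d = Min (insert 1 (e ` {..<n}))"
  have "d > 0" unfolding d_def using e(1) by (subst Min_gr_iff) auto
  moreover have d: "d \<le> e i" if "i < n" for i unfolding d_def using that by (intro Min_le) auto
  moreover have "x \<in> V" if x: "\<forall>i<n. \<bar>x i - a i\<bar> \<le> d" "\<forall>i\<ge>n. x i = 0" for x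
  proof -
    have "x i \<in> X i" for i
    proof (cases "i < n")
      case True
      then have "x i \<in> cball (a i) (e i)"
        using x(1) d[OF True] by (force simp: dist_real_def abs_minus_commute)
      then show ?thesis using e(2) by blast
    next
      case False
      then have "x i = a i" using x(2) assms(2) T(2) by (simp add: topspace_Euclidean_space)
      then show ?thesis using X(3) by auto
    qed
    then show ?thesis using X(4) T(2) x(2) by (auto simp: topspace_Euclidean_space)
  qed
  ultimately show ?thesis using that by blast
qed

text \<open>
  In a chart around \<open>p\<close> the function is the product over the coordinates of
  \<open>flat 1 (e\<^sup>2 - (x\<^sub>i - p\<^sub>i)\<^sup>2)\<close>, which is supported in a cube. The cube is compact, hence so is its preimage
  in the manifold, and compact sets in a Hausdorff space are closed; this makes the extension by 0 smooth.
\<close>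

lemma exists_bump_function:
  assumes M: "smooth_manifold M" and W: "open W" "p \<in> W"
  obtains b K where "smooth_on M UNIV b" "b p \<noteq> 0" "closed K" "K \<subseteq> W" "\<And>q. q \<notin> K \<Longrightarrow> b q = 0"
proof -
  let ?n = "mfd_dim M"
  obtain U \<phi> where ch: "(U, \<phi>) \<in> charts M" "p \<in> U"
    using M unfolding smooth_manifold_def by fast
  note c = smooth_manifold_chart[OF M ch(1)]
  define B where "B e = {x. (\<forall>i<?n. \<bar>x i - \<phi> p i\<bar> \<le> e) \<and> (\<forall>i\<ge>?n. x i = 0)}" for e
  have "\<phi> p \<in> \<phi> ` (U \<inter> W)" using ch(2) W(2) by blast
  then obtain e where e: "e > 0" "B e \<subseteq> \<phi> ` (U \<inter> W)"
    unfolding B_def by (rule coordinate_box_subset_open[OF chart_image_open[OF M ch(1) W(1)]])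
  define K where "K = inv_into U \<phi> ` (B e)"
  have "continuous_on (B e) (inv_into U \<phi>)"
    by (rule continuous_on_subset[OF homeomorphism_cont2[OF c(3)]]) (use e(2) in blast)
  then have "compact K"
    unfolding K_def using compact_coordinate_box[of ?n "\<phi> p" e, folded B_def]
    by (rule compact_continuous_image)
  then have "closed K" by (rule compact_imp_closed)
  have KW: "K \<subseteq> U \<inter> W"
    unfolding K_def using e(2) c(4) by fastforce
  define \<beta> where "\<beta> q = (\<Prod>i<?n. flat 1 (e\<^sup>2 - (\<phi> q i - \<phi> p i) * (\<phi> q i - \<phi> p i)))" for q
  define b where "b q = (if q \<in> U then \<beta> q else 0)" for q
  have b0: "b q = 0" if "q \<notin> K" for q
  proof (cases "q \<in> U")
    case True
    then have "\<phi> q \<notin> B e" using that c(4)[OF True] unfolding K_def by (metis image_eqI)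
    moreover have "\<forall>i\<ge>?n. \<phi> q i = 0"
      using openin_subset[OF c(2)] True by (auto simp: topspace_Euclidean_space)
    ultimately obtain i where i: "i < ?n" "\<bar>\<phi> q i - \<phi> p i\<bar> > e"
      unfolding B_def by (auto simp: not_le)
    then have "e\<^sup>2 < (\<phi> q i - \<phi> p i) * (\<phi> q i - \<phi> p i)"
      using e(1) abs_le_square_iff[of "\<phi> q i - \<phi> p i" e] by (simp add: power2_eq_square)
    then have "flat 1 (e\<^sup>2 - (\<phi> q i - \<phi> p i) * (\<phi> q i - \<phi> p i)) = 0" by (simp add: flat_def)
    then show ?thesis using i(1) by (auto simp: b_def \<beta>_def)
  qed (simp add: b_def)
  have "smooth_on M U b"
  proof -
    have "smooth_on M U \<beta>"
      unfolding \<beta>_def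
      by (intro smooth_on_prod smooth_on_flat smooth_on_diff smooth_on_mult smooth_on_const
          smooth_on_coordinate[OF M ch(1)] M c(1)) auto
    then show ?thesis
      by (rule smooth_on_cong_imp[OF M c(1), rotated]) (simp add: b_def)
  qed
  moreover have "smooth_on M (-K) b"
    by (rule smooth_on_cong_imp[OF M, of _ _ "\<lambda>_. 0"])
      (use b0 open_Compl[OF \<open>closed K\<close>] smooth_on_const[OF M] in auto)
  ultimately have "smooth_on M UNIV b"
  proof (intro smooth_on_local[OF M])
    fix q :: 'a
    assume s: "smooth_on M U b" "smooth_on M (- K) b"
    show "\<exists>W'. open W' \<and> q \<in> W' \<and> smooth_on M W' b"
    proof (cases "q \<in> U")
      case True
      then show ?thesis using s c(1) by blast
    next
      case False
      then show ?thesis using s \<open>closed K\<close> KW by (intro exI[of _ "-K"]) auto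
    qed
  qed simp
  moreover have "b p \<noteq> 0"
    using ch(2) e(1) by (simp add: b_def \<beta>_def flat_def)
  ultimately show ?thesis using that[of b K] KW \<open>closed K\<close> b0 by blast
qed


section \<open>Smooth systems of linear equations\<close>

text \<open>The determinant is a polynomial in the entries.\<close>

lemma smooth_on_det:
  assumes "smooth_manifold M" "open W"
    and H: "\<And>i j. i < r \<Longrightarrow> j < r \<Longrightarrow> smooth_on M W (H i j)"
  shows "smooth_on M W (\<lambda>p. Determinant.det (Matrix.mat r r (\<lambda>(i, j). H i j p)))"
proof -
  have "Determinant.det (Matrix.mat r r (\<lambda>(i, j). H i j p)) =
      (\<Sum>\<pi>\<in>{\<pi>. \<pi> permutes {0..<r}}. signof \<pi> * (\<Prod>i=0..<r. H i (\<pi> i) p))" for p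
    unfolding Determinant.det_def
    by (auto intro!: sum.cong prod.cong arg_cong2[where f = "(*)"] simp: permutes_in_image
        dest: permutes_in_image[THEN iffD2])
  moreover have "smooth_on M W
      (\<lambda>p. \<Sum>\<pi>\<in>{\<pi>. \<pi> permutes {0..<r}}. signof \<pi> * (\<Prod>i=0..<r. H i (\<pi> i) p))"
    by (intro smooth_on_sum smooth_on_mult smooth_on_prod smooth_on_const assms(1,2) H)
      (auto dest: permutes_in_image[THEN iffD2])
  ultimately show ?thesis by simp
qed

text \<open>
  Cramer's rule writes the solution as a quotient of determinants of smooth matrices.
\<close>

lemma smooth_solution_of_linear_system:
  fixes r :: nat
  assumes M: "smooth_manifold M" and W: "open W"
    and G: "\<And>i j. i < r \<Longrightarrow> j < r \<Longrightarrow> smooth_on M W (G i j)"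
    and b: "\<And>i. i < r \<Longrightarrow> smooth_on M W (b i)"
    and inj: "\<And>p c. p \<in> W \<Longrightarrow> (\<And>i. i < r \<Longrightarrow> (\<Sum>j<r. G i j p * c j) = 0) \<Longrightarrow> \<forall>j<r. c j = 0"
  obtains w where "\<And>j. j < r \<Longrightarrow> smooth_on M W (w j)"
    and "\<And>p i. p \<in> W \<Longrightarrow> i < r \<Longrightarrow> (\<Sum>j<r. G i j p * w j p) = b i p"
proof -
  define D where "D p = Matrix.mat r r (\<lambda>(i, j). G i j p)" for p
  define C where "C k p = Matrix.mat r r (\<lambda>(i, j). if j = k then b i p else G i j p)" for k p
  define w where "w k p = inverse (Determinant.det (D p)) * Determinant.det (C k p)" for k p
  have D: "D p \<in> carrier_mat r r" for p by (simp add: D_def)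
  have Dv: "vec_index (D p *\<^sub>v v) i = (\<Sum>j<r. G i j p * vec_index v j)"
    if "v \<in> carrier_vec r" "i < r" for p v i
    using that by (auto simp: D_def scalar_prod_def lessThan_atLeast0 intro!: sum.cong)
  have det: "Determinant.det (D p) \<noteq> 0" if p: "p \<in> W" for p
  proof
    assume "Determinant.det (D p) = 0"
    then obtain v where v: "v \<in> carrier_vec r" "v \<noteq> 0\<^sub>v r" "D p *\<^sub>v v = 0\<^sub>v r"
      using det_0_iff_vec_prod_zero_field[OF D] by blast
    have "(\<Sum>j<r. G i j p * vec_index v j) = 0" if "i < r" for i
      using Dv[OF v(1) that, of p] v(3) that by simp
    then have "\<forall>j<r. vec_index v j = 0" by (rule inj[OF p])
    then have "v = 0\<^sub>v r" using v(1) by (intro eq_vecI) auto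
    then show False using v(2) by blast
  qed
  have "(\<Sum>j<r. G i j p * w j p) = b i p" if p: "p \<in> W" and i: "i < r" for p i
  proof -
    define \<beta> where "\<beta> = Matrix.vec r (\<lambda>i. b i p)"
    define x where "x = inverse (Determinant.det (D p)) \<cdot>\<^sub>v (adj_mat (D p) *\<^sub>v \<beta>)"
    have \<beta>: "\<beta> \<in> carrier_vec r" by (simp add: \<beta>_def)
    note adj = adj_mat[OF D[of p]]
    have x: "x \<in> carrier_vec r" using adj(1) \<beta> by (simp add: x_def)
    have "D p *\<^sub>v x = inverse (Determinant.det (D p)) \<cdot>\<^sub>v ((D p * adj_mat (D p)) *\<^sub>v \<beta>)"
      using D[of p] adj(1) \<beta> by (simp add: x_def mult_mat_vec assoc_mult_mat_vec[of _ r r _ r])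
    also have "(D p * adj_mat (D p)) *\<^sub>v \<beta> = Determinant.det (D p) \<cdot>\<^sub>v (1\<^sub>m r *\<^sub>v \<beta>)"
      unfolding adj(2) using \<beta> by auto
    also have "inverse (Determinant.det (D p)) \<cdot>\<^sub>v \<dots> = \<beta>"
      using \<beta> det[OF p] by (simp add: smult_smult_assoc)
    finally have sol: "D p *\<^sub>v x = \<beta>" .
    have "w k p = vec_index x k" if k: "k < r" for k
    proof -
      have "C k p = replace_col (D p) \<beta> k"
        unfolding C_def replace_col_def D_def \<beta>_def by (intro eq_matI) auto
      then show ?thesis
        using cramer_lemma_mat[OF D x k, of p] sol det[OF p] by (simp add: w_def)
    qed
    then have "(\<Sum>j<r. G i j p * w j p) = vec_index (D p *\<^sub>v x) i"
      unfolding Dv[OF x i] by simp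
    then show ?thesis using sol i by (simp add: \<beta>_def)
  qed
  moreover have "smooth_on M W (w k)" for k
  proof -
    have "smooth_on M W (\<lambda>p. if j = k then b i p else G i j p)" if "i < r" "j < r" for i j
      using G b that by (cases "j = k") auto
    then show ?thesis
      unfolding w_def C_def D_def
      by (intro smooth_on_mult smooth_on_inverse smooth_on_det M W) (use G det in \<open>auto simp: D_def\<close>)
  qed
  ultimately show ?thesis using that by blast
qed


section \<open>Frames and sections of vector bundles\<close>

lemma linear_on_fibre_sum:
  assumes "linear_on_fibre E f" "subspace E" "\<And>j. j \<in> J \<Longrightarrow> u j \<in> E"
  shows "f (\<Sum>j\<in>J. c j *\<^sub>R u j) = (\<Sum>j\<in>J. c j * f (u j))"
  using assms(3)
proof (induction J rule: infinite_finite_induct)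
  case (insert j J)
  have "(\<Sum>j\<in>J. c j *\<^sub>R u j) \<in> E" "c j *\<^sub>R u j \<in> E" "u j \<in> E"
    using insert.prems assms(2) by (auto intro: subspace_sum subspace_scale)
  then show ?case
    using insert assms(1) by (simp add: linear_on_fibre_def)
next
  case empty
  have "f (0 *\<^sub>R 0) = 0 * f 0"
    using assms(1) subspace_0[OF assms(2)] unfolding linear_on_fibre_def by blast
  then show ?case by simp
next
  case (infinite J)
  have "f (0 *\<^sub>R 0) = 0 * f 0"
    using assms(1) subspace_0[OF assms(2)] unfolding linear_on_fibre_def by blast
  then show ?case using infinite by simp
qed

locale vector_bundle =
  fixes A :: "('m::{t2_space,second_countable_topology}, 'v::real_vector, 'z) vbundle_scheme"
  assumes vbundle: "smooth_vbundle A"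
begin

lemma manifold: "smooth_manifold A"
  using vbundle by (simp add: smooth_vbundle_def)

lemma subspace_fibre: "subspace (fibre A p)"
  using vbundle by (simp add: smooth_vbundle_def)

lemma trivialization_at:
  obtains U r \<Phi> where "(U, r, \<Phi>) \<in> trivs A" "p \<in> U"
proof -
  have "p \<in> (\<Union>(U, r, \<Phi>)\<in>trivs A. U)" using vbundle by (simp add: smooth_vbundle_def)
  then show ?thesis using that by auto
qed

lemma smooth_on_frame_change:
  assumes "(U, r, \<Phi>) \<in> trivs A" "(V, s, \<Psi>) \<in> trivs A" "j < r" "i < s"
  shows "smooth_on A (U \<inter> V) (\<lambda>p. \<Psi> p (frame A \<Phi> j p) i)"
proof -
  have "\<forall>(U, r, \<Phi>)\<in>trivs A. \<forall>(V, s, \<Psi>)\<in>trivs A. \<forall>j<r. \<forall>i<s.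
        smooth_on A (U \<inter> V) (\<lambda>p. \<Psi> p (frame A \<Phi> j p) i)"
    using vbundle unfolding smooth_vbundle_def by (elim conjE)
  from bspec[OF this assms(1)] have "\<forall>(V, s, \<Psi>)\<in>trivs A. \<forall>j<r. \<forall>i<s.
        smooth_on A (U \<inter> V) (\<lambda>p. \<Psi> p (frame A \<Phi> j p) i)"
    by simp
  from bspec[OF this assms(2)] show ?thesis using assms(3,4) by simp
qed

context
  fixes U r \<Phi>
  assumes triv: "(U, r, \<Phi>) \<in> trivs A"
begin

lemma trivialization:
  shows "open U"
    and "p \<in> U \<Longrightarrow> bij_betw (\<Phi> p) (fibre A p) (topspace (Euclidean_space r))"
    and "p \<in> U \<Longrightarrow> linear_on_fibre (fibre A p) (\<lambda>v. \<Phi> p v i)"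
proof -
  have "\<forall>(U, r, \<Phi>)\<in>trivs A. open U \<and>
      (\<forall>p\<in>U. bij_betw (\<Phi> p) (fibre A p) (topspace (Euclidean_space r)) \<and>
        (\<forall>i. linear_on_fibre (fibre A p) (\<lambda>v. \<Phi> p v i)))"
    using vbundle unfolding smooth_vbundle_def by (elim conjE)
  from bspec[OF this triv]
  show "open U"
    and "p \<in> U \<Longrightarrow> bij_betw (\<Phi> p) (fibre A p) (topspace (Euclidean_space r))"
    and "p \<in> U \<Longrightarrow> linear_on_fibre (fibre A p) (\<lambda>v. \<Phi> p v i)"
    by simp_all
qed

lemma frame:
  assumes "p \<in> U" "j < r"
  shows "frame A \<Phi> j p \<in> fibre A p" "\<Phi> p (frame A \<Phi> j p) = (\<lambda>i. if i = j then 1 else 0)"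
proof -
  have "(\<lambda>i. if i = j then 1 else 0) \<in> \<Phi> p ` fibre A p"
    using trivialization(2)[OF assms(1)] assms(2)
    by (auto simp: bij_betw_def topspace_Euclidean_space)
  then show "frame A \<Phi> j p \<in> fibre A p" "\<Phi> p (frame A \<Phi> j p) = (\<lambda>i. if i = j then 1 else 0)"
    unfolding frame_def by (auto intro: inv_into_into f_inv_into_f)
qed

lemma frame_combination:
  assumes "p \<in> U"
  shows "(\<Sum>j<r. c j *\<^sub>R frame A \<Phi> j p) \<in> fibre A p"
    and "\<Phi> p (\<Sum>j<r. c j *\<^sub>R frame A \<Phi> j p) i = (if i < r then c i else 0)"
proof -
  show "(\<Sum>j<r. c j *\<^sub>R frame A \<Phi> j p) \<in> fibre A p"
    using frame(1)[OF assms] by (auto intro!: subspace_sum subspace_scale subspace_fibre)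
  have "\<Phi> p (\<Sum>j<r. c j *\<^sub>R frame A \<Phi> j p) i = (\<Sum>j<r. c j * \<Phi> p (frame A \<Phi> j p) i)"
    using frame(1)[OF assms]
    by (intro linear_on_fibre_sum[OF trivialization(3)[OF assms] subspace_fibre]) auto
  also have "\<dots> = (\<Sum>j<r. if i = j then c j else 0)"
    using frame(2)[OF assms] by (intro sum.cong) auto
  also have "\<dots> = (if i < r then c i else 0)" by simp
  finally show "\<Phi> p (\<Sum>j<r. c j *\<^sub>R frame A \<Phi> j p) i = (if i < r then c i else 0)" .
qed

lemma frame_expansion:
  assumes "p \<in> U" "v \<in> fibre A p"
  shows "v = (\<Sum>j<r. \<Phi> p v j *\<^sub>R frame A \<Phi> j p)"
proof (rule inj_onD[OF bij_betw_imp_inj_on[OF trivialization(2)[OF assms(1)]] _ assms(2)])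
  have "\<Phi> p v \<in> topspace (Euclidean_space r)"
    using trivialization(2)[OF assms(1)] assms(2) by (auto simp: bij_betw_def)
  then show "\<Phi> p v = \<Phi> p (\<Sum>j<r. \<Phi> p v j *\<^sub>R frame A \<Phi> j p)"
    using frame_combination(2)[OF assms(1)] by (auto simp: topspace_Euclidean_space fun_eq_iff)
qed (rule frame_combination(1)[OF assms(1)])

lemma linear_on_fibre_expansion:
  assumes "p \<in> U" "v \<in> fibre A p" "linear_on_fibre (fibre A p) f"
  shows "f v = (\<Sum>j<r. \<Phi> p v j * f (frame A \<Phi> j p))"
  by (subst frame_expansion[OF assms(1,2)],
      rule linear_on_fibre_sum[OF assms(3) subspace_fibre]) (use frame(1)[OF assms(1)] in auto)

text \<open>
  A fibrewise linear function applied to a section is the sum of its values on the frame, weighted by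
  the components of the section. So it suffices to know smoothness on the frame, and that is how bundle
  morphisms and metrics are specified.
\<close>

lemma smooth_on_linear_apply:
  assumes X: "\<And>p. p \<in> U \<Longrightarrow> X p \<in> fibre A p" "\<And>i. i < r \<Longrightarrow> smooth_on A U (\<lambda>p. \<Phi> p (X p) i)"
    and L: "\<And>p. p \<in> U \<Longrightarrow> linear_on_fibre (fibre A p) (L p)"
      "\<And>j. j < r \<Longrightarrow> smooth_on A U (\<lambda>p. L p (frame A \<Phi> j p))"
  shows "smooth_on A U (\<lambda>p. L p (X p))"
proof (rule smooth_on_cong_imp[OF manifold trivialization(1)])
  show "L p (X p) = (\<Sum>j<r. \<Phi> p (X p) j * L p (frame A \<Phi> j p))" if "p \<in> U" for p
    using linear_on_fibre_expansion[OF that X(1) L(1)] that by blast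
  show "smooth_on A U (\<lambda>p. \<Sum>j<r. \<Phi> p (X p) j * L p (frame A \<Phi> j p))"
    by (intro smooth_on_sum smooth_on_mult manifold trivialization(1) X L) auto
qed

end

lemma Sec_fibre: "X \<in> Sec A \<Longrightarrow> X p \<in> fibre A p"
  by (simp add: Sec_def)

lemma Sec_smooth:
  assumes "X \<in> Sec A" "(U, r, \<Phi>) \<in> trivs A" "i < r"
  shows "smooth_on A U (\<lambda>p. \<Phi> p (X p) i)"
proof -
  have "\<forall>(U, r, \<Phi>)\<in>trivs A. \<forall>i<r. smooth_on A U (\<lambda>p. \<Phi> p (X p) i)"
    using assms(1) by (simp add: Sec_def)
  from bspec[OF this assms(2)] show ?thesis using assms(3) by simp
qed

lemma SecI:
  assumes "\<And>p. X p \<in> fibre A p"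
    "\<And>U r \<Phi> i. (U, r, \<Phi>) \<in> trivs A \<Longrightarrow> i < r \<Longrightarrow> smooth_on A U (\<lambda>p. \<Phi> p (X p) i)"
  shows "X \<in> Sec A"
  using assms unfolding Sec_def by blast

lemma sec_add_Sec:
  assumes "X \<in> Sec A" "Y \<in> Sec A"
  shows "sec_add X Y \<in> Sec A"
proof (rule SecI)
  show "sec_add X Y p \<in> fibre A p" for p
    using assms by (simp add: sec_add_def Sec_fibre subspace_add subspace_fibre)
  fix U r \<Phi> i assume t: "(U, r, \<Phi>) \<in> trivs A" and i: "i < (r :: nat)"
  show "smooth_on A U (\<lambda>p. \<Phi> p (sec_add X Y p) i)"
  proof (rule smooth_on_cong_imp[OF manifold trivialization(1)[OF t]])
    show "\<Phi> p (sec_add X Y p) i = \<Phi> p (X p) i + \<Phi> p (Y p) i" if "p \<in> U" for p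
      using trivialization(3)[OF t that] assms
      by (simp add: linear_on_fibre_def sec_add_def Sec_fibre)
    show "smooth_on A U (\<lambda>p. \<Phi> p (X p) i + \<Phi> p (Y p) i)"
      by (intro smooth_on_add manifold trivialization(1)[OF t] Sec_smooth[OF _ t i] assms)
  qed
qed

lemma sec_map_Sec:
  assumes N: "bundle_endomorphism A N" and X: "X \<in> Sec A"
  shows "sec_map N X \<in> Sec A"
proof (rule SecI)
  show "sec_map N X p \<in> fibre A p" for p
    using N Sec_fibre[OF X] by (simp add: sec_map_def bundle_endomorphism_def)
  fix U r \<Phi> i assume t: "(U, r, \<Phi>) \<in> trivs A" and i: "i < (r :: nat)"
  have "smooth_on A U (\<lambda>p. (\<lambda>u. \<Phi> p (N p u) i) (X p))"
  proof (rule smooth_on_linear_apply[OF t Sec_fibre[OF X] Sec_smooth[OF X t]])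
    show "linear_on_fibre (fibre A p) (\<lambda>u. \<Phi> p (N p u) i)" if "p \<in> U" for p
      using trivialization(3)[OF t that, of i] N
      unfolding linear_on_fibre_def bundle_endomorphism_def by simp
    show "smooth_on A U (\<lambda>p. \<Phi> p (N p (frame A \<Phi> j p)) i)" if "j < r" for j
      using N t i that unfolding bundle_endomorphism_def by fast
  qed
  then show "smooth_on A U (\<lambda>p. \<Phi> p (sec_map N X p) i)" by (simp add: sec_map_def)
qed

text \<open>
  The combination of frame sections with the components of \<open>v\<close> at \<open>p\<close> as constant coefficients passes
  through \<open>v\<close>. A bump function supported in the domain of the frame extends it to the whole base.
\<close>

lemma exists_section_through:
  assumes v: "v \<in> fibre A p"
  obtains X where "X \<in> Sec A" "X p = v"
proof -
  obtain U r \<Phi> where t: "(U, r, \<Phi>) \<in> trivs A" "p \<in> U" by (rule trivialization_at)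
  obtain b K where b: "smooth_on A UNIV b" "b p \<noteq> 0" "closed K" "K \<subseteq> U" "\<And>q. q \<notin> K \<Longrightarrow> b q = 0"
    using exists_bump_function[OF manifold trivialization(1)[OF t(1)] t(2)] by blast
  define E where "E q = (\<Sum>j<r. \<Phi> p v j *\<^sub>R frame A \<Phi> j q)" for q
  define X where "X q = (if q \<in> U then (b q / b p) *\<^sub>R E q else 0)" for q
  have E: "E q \<in> fibre A q" if "q \<in> U" for q
    unfolding E_def by (rule frame_combination(1)[OF t(1) that])
  have "X \<in> Sec A"
  proof (rule SecI)
    show "X q \<in> fibre A q" for q
      using E subspace_fibre by (simp add: X_def subspace_scale subspace_0)
    fix V s \<Psi> i assume t': "(V, s, \<Psi>) \<in> trivs A" and i: "i < (s :: nat)"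
    note oV = trivialization(1)[OF t'] note oU = trivialization(1)[OF t(1)]
    note lin = trivialization(3)[OF t', of _ i]
    \<comment> \<open>\<open>X\<close> is smooth on \<open>U\<close> by construction and zero off \<open>K\<close>; these two open sets cover the base.\<close>
    have 1: "smooth_on A (U \<inter> V) (\<lambda>q. \<Psi> q (X q) i)"
    proof (rule smooth_on_cong_imp[OF manifold])
      show "open (U \<inter> V)" using oU oV by blast
      show "\<Psi> q (X q) i = b q * inverse (b p) * (\<Sum>j<r. \<Phi> p v j * \<Psi> q (frame A \<Phi> j q) i)"
        if "q \<in> U \<inter> V" for q
      proof -
        have "\<Psi> q (X q) i = b q * inverse (b p) * \<Psi> q (E q) i"
          using that lin[of q] E[of q] by (simp add: X_def linear_on_fibre_def divide_inverse)
        also have "\<Psi> q (E q) i = (\<Sum>j<r. \<Phi> p v j * \<Psi> q (frame A \<Phi> j q) i)"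
          unfolding E_def using that frame(1)[OF t(1)]
          by (intro linear_on_fibre_sum[OF lin subspace_fibre]) auto
        finally show ?thesis .
      qed
      show "smooth_on A (U \<inter> V) (\<lambda>q. b q * inverse (b p) * (\<Sum>j<r. \<Phi> p v j * \<Psi> q (frame A \<Phi> j q) i))"
        by (intro smooth_on_mult smooth_on_sum smooth_on_const manifold open_Int oU oV
            smooth_on_subset[OF b(1)] smooth_on_frame_change[OF t(1) t'] i) auto
    qed
    have 2: "smooth_on A (V \<inter> -K) (\<lambda>q. \<Psi> q (X q) i)"
    proof (rule smooth_on_cong_imp[OF manifold])
      show op: "open (V \<inter> -K)" using oV b(3) by blast
      show "\<Psi> q (X q) i = 0" if "q \<in> V \<inter> -K" for q
      proof -
        have "X q = 0 *\<^sub>R 0" using that b(5) by (simp add: X_def)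
        moreover have "\<Psi> q (0 *\<^sub>R 0) i = 0 * \<Psi> q 0 i"
          using lin[of q] that subspace_0[OF subspace_fibre] unfolding linear_on_fibre_def by blast
        ultimately show ?thesis by simp
      qed
      show "smooth_on A (V \<inter> -K) (\<lambda>_. 0)" by (rule smooth_on_const[OF manifold op])
    qed
    show "smooth_on A V (\<lambda>q. \<Psi> q (X q) i)"
    proof (rule smooth_on_local[OF manifold oV])
      fix q assume q: "q \<in> V"
      show "\<exists>W'. open W' \<and> q \<in> W' \<and> smooth_on A W' (\<lambda>q. \<Psi> q (X q) i)"
      proof (cases "q \<in> U")
        case True
        then show ?thesis using 1 q oU oV by blast
      next
        case False
        then show ?thesis using 2 q b(3,4) oV by (intro exI[of _ "V \<inter> -K"]) auto
      qed
    qed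
  qed
  moreover have "X p = v"
    using t(2) b(2) frame_expansion[OF t v] by (simp add: X_def E_def)
  ultimately show ?thesis by (rule that)
qed

end


section \<open>Bundle metrics and adjoints\<close>

locale metric_bundle = vector_bundle A
  for A :: "('m::{t2_space,second_countable_topology}, 'v::real_vector, 'z) vbundle_scheme" +
  fixes g :: "'m \<Rightarrow> 'v \<Rightarrow> 'v \<Rightarrow> real"
  assumes metric: "bundle_metric A g"
begin

lemma metric_linear: "u \<in> fibre A p \<Longrightarrow> linear_on_fibre (fibre A p) (g p u)"
  using metric by (simp add: bundle_metric_def)

lemma metric_sym: "u \<in> fibre A p \<Longrightarrow> v \<in> fibre A p \<Longrightarrow> g p u v = g p v u"
  using metric by (simp add: bundle_metric_def)

lemma metric_nondegenerate:
  "u \<in> fibre A p \<Longrightarrow> (\<And>v. v \<in> fibre A p \<Longrightarrow> g p u v = 0) \<Longrightarrow> u = 0"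
  using metric by (simp add: bundle_metric_def)

lemma metric_add:
  assumes "u \<in> fibre A p" "v \<in> fibre A p" "w \<in> fibre A p"
  shows "g p u (v + w) = g p u v + g p u w" "g p (v + w) u = g p v u + g p w u"
  using metric_linear[OF assms(1)] assms
  by (simp_all add: metric_sym[OF _ assms(1)] subspace_add subspace_fibre linear_on_fibre_def)

lemma metric_diff:
  assumes "u \<in> fibre A p" "v \<in> fibre A p" "w \<in> fibre A p"
  shows "g p u (v - w) = g p u v - g p u w" "g p (v - w) u = g p v u - g p w u"
  using metric_add[OF assms(1) subspace_diff[OF subspace_fibre assms(2,3)] assms(3)] by simp_all

lemma metric_linear_left:
  assumes "v \<in> fibre A p"
  shows "linear_on_fibre (fibre A p) (\<lambda>u. g p u v)"
  using metric_linear[OF assms] assms subspace_fibre[of p]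
  by (simp add: linear_on_fibre_def metric_sym[OF _ assms] subspace_add subspace_scale)

lemma eq_if_metric_eq:
  assumes "v \<in> fibre A p" "w \<in> fibre A p" "\<And>u. u \<in> fibre A p \<Longrightarrow> g p u v = g p u w"
  shows "v = w"
proof -
  have d: "v - w \<in> fibre A p" by (rule subspace_diff[OF subspace_fibre assms(1,2)])
  have "g p (v - w) u = 0" if "u \<in> fibre A p" for u
    using metric_diff(2)[OF that assms(1,2)] assms(3)[OF that]
      metric_sym[OF that assms(1)] metric_sym[OF that assms(2)] by simp
  then show ?thesis using metric_nondegenerate[OF d] by simp
qed

lemma smooth_on_metric_local:
  assumes t: "(U, r, \<Phi>) \<in> trivs A"
    and X: "\<And>p. p \<in> U \<Longrightarrow> X p \<in> fibre A p" "\<And>i. i < r \<Longrightarrow> smooth_on A U (\<lambda>p. \<Phi> p (X p) i)"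
    and Y: "\<And>p. p \<in> U \<Longrightarrow> Y p \<in> fibre A p" "\<And>i. i < r \<Longrightarrow> smooth_on A U (\<lambda>p. \<Phi> p (Y p) i)"
  shows "smooth_on A U (\<lambda>p. g p (X p) (Y p))"
proof (rule smooth_on_linear_apply[OF t Y])
  show "linear_on_fibre (fibre A p) (g p (X p))" if "p \<in> U" for p
    by (rule metric_linear[OF X(1)[OF that]])
  fix j assume j: "j < r"
  have "smooth_on A U (\<lambda>p. g p (frame A \<Phi> j p) (X p))"
  proof (rule smooth_on_linear_apply[OF t X])
    show "linear_on_fibre (fibre A p) (g p (frame A \<Phi> j p))" if "p \<in> U" for p
      by (rule metric_linear[OF frame(1)[OF t that j]])
    have "\<forall>(U, r, \<Phi>)\<in>trivs A. \<forall>i<r. \<forall>j<r.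
        smooth_on A U (\<lambda>p. g p (frame A \<Phi> i p) (frame A \<Phi> j p))"
      using metric unfolding bundle_metric_def by (elim conjE)
    from bspec[OF this t] j
    show "smooth_on A U (\<lambda>p. g p (frame A \<Phi> j p) (frame A \<Phi> i p))" if "i < r" for i
      using that by simp
  qed
  then show "smooth_on A U (\<lambda>p. g p (X p) (frame A \<Phi> j p))"
    by (rule smooth_on_cong_imp[OF manifold trivialization(1)[OF t], rotated])
      (rule metric_sym[OF X(1) frame(1)[OF t _ j]])
qed

lemma smooth_on_metric:
  assumes "X \<in> Sec A" "Y \<in> Sec A"
  shows "smooth_on A UNIV (sec_pair g X Y)"
proof (rule smooth_on_local[OF manifold open_UNIV])
  fix p
  obtain U r \<Phi> where t: "(U, r, \<Phi>) \<in> trivs A" "p \<in> U" by (rule trivialization_at)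
  have "smooth_on A U (sec_pair g X Y)"
    unfolding sec_pair_def
    by (rule smooth_on_metric_local[OF t(1) Sec_fibre[OF assms(1)] Sec_smooth[OF assms(1) t(1)]
        Sec_fibre[OF assms(2)] Sec_smooth[OF assms(2) t(1)]])
  then show "\<exists>W'. open W' \<and> p \<in> W' \<and> smooth_on A W' (sec_pair g X Y)"
    using trivialization(1)[OF t(1)] t(2) by blast
qed

text \<open>
  Nondegeneracy in the fibres carries over to sections because sections take all values.
\<close>

lemma sections_eq_if_pairings_eq:
  assumes X: "X \<in> Sec A" "Y \<in> Sec A"
    and "\<And>Z p. Z \<in> Sec A \<Longrightarrow> sec_pair g Z X p = sec_pair g Z Y p"
  shows "X = Y"
proof
  fix p
  show "X p = Y p"
  proof (rule eq_if_metric_eq[OF Sec_fibre Sec_fibre])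
    fix u assume "u \<in> fibre A p"
    then obtain Z where "Z \<in> Sec A" "Z p = u" by (rule exists_section_through)
    then show "g p u (X p) = g p u (Y p)" using assms(3)[of Z p] by (simp add: sec_pair_def)
  qed (rule X)+
qed

text \<open>A null vector of the Gram matrix of a frame is orthogonal to the whole fibre.\<close>

lemma metric_frame_injective:
  assumes t: "(U, r, \<Phi>) \<in> trivs A" and p: "p \<in> U"
    and 0: "\<And>i. i < r \<Longrightarrow> (\<Sum>j<r. g p (frame A \<Phi> i p) (frame A \<Phi> j p) * c j) = 0"
  shows "\<forall>j<r. c j = 0"
proof -
  let ?w = "\<Sum>j<r. c j *\<^sub>R frame A \<Phi> j p"
  note w = frame_combination[OF t p, of c]
  have fw: "g p (frame A \<Phi> i p) ?w = 0" if "i < r" for i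
    using linear_on_fibre_sum[OF metric_linear[OF frame(1)[OF t p that]] subspace_fibre,
        of "{..<r}" "\<lambda>j. frame A \<Phi> j p" c] frame(1)[OF t p] 0[OF that]
    by (simp add: mult.commute)
  have "?w = 0"
  proof (rule metric_nondegenerate[OF w(1)])
    fix v assume v: "v \<in> fibre A p"
    have "g p ?w v = (\<Sum>j<r. \<Phi> p v j * g p ?w (frame A \<Phi> j p))"
      by (rule linear_on_fibre_expansion[OF t p v metric_linear[OF w(1)]])
    also have "\<dots> = 0"
      using fw metric_sym[OF w(1) frame(1)[OF t p]] by simp
    finally show "g p ?w v = 0" .
  qed
  moreover have "\<Phi> p 0 i = 0" for i
  proof -
    have "\<Phi> p (0 *\<^sub>R 0) i = 0 * \<Phi> p 0 i"
      using trivialization(3)[OF t p, of i] subspace_0[OF subspace_fibre]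
      unfolding linear_on_fibre_def by blast
    then show ?thesis by simp
  qed
  ultimately show ?thesis using w(2) by metis
qed

text \<open>
  The components of the adjoint of \<open>N\<close> applied to \<open>Y\<close> solve a linear system: its matrix consists of the
  pairings of the frame sections \<open>e\<^sub>i\<close>, its right-hand side of the functions \<open>\<langle>N e\<^sub>i, Y\<rangle>\<close>.
\<close>

lemma local_adjoint:
  assumes N: "bundle_endomorphism A N" and t: "(U, r, \<Phi>) \<in> trivs A" and Y: "Y \<in> Sec A"
  obtains w where "\<And>j. j < r \<Longrightarrow> smooth_on A U (w j)"
    and "\<And>p u. p \<in> U \<Longrightarrow> u \<in> fibre A p \<Longrightarrow>
      g p (N p u) (Y p) = g p u (\<Sum>j<r. w j p *\<^sub>R frame A \<Phi> j p)"
proof -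
  let ?e = "frame A \<Phi>"
  have Nf: "N p u \<in> fibre A p" if "u \<in> fibre A p" for p u
    using N that by (simp add: bundle_endomorphism_def)
  have e: "smooth_on A U (\<lambda>p. \<Phi> p (?e j p) i)" if "i < r" "j < r" for i j
    using smooth_on_frame_change[OF t t] that by simp
  have "\<forall>(U, r, \<Phi>)\<in>trivs A. \<forall>j<r. \<forall>i<r. smooth_on A U (\<lambda>p. \<Phi> p (N p (frame A \<Phi> j p)) i)"
    using N unfolding bundle_endomorphism_def by (elim conjE)
  from bspec[OF this t]
  have Ne: "smooth_on A U (\<lambda>p. \<Phi> p (N p (?e j p)) i)" if "i < r" "j < r" for i j
    using that by simp
  have G: "smooth_on A U (\<lambda>p. g p (?e i p) (?e j p))" if "i < r" "j < r" for i j
    using that by (intro smooth_on_metric_local[OF t] frame(1)[OF t] e)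
  have b: "smooth_on A U (\<lambda>p. g p (N p (?e i p)) (Y p))" if "i < r" for i
    using that by (intro smooth_on_metric_local[OF t] Nf frame(1)[OF t] Ne Sec_fibre[OF Y] Sec_smooth[OF Y t])
  obtain w where w: "\<And>j. j < r \<Longrightarrow> smooth_on A U (w j)"
    "\<And>p i. p \<in> U \<Longrightarrow> i < r \<Longrightarrow>
      (\<Sum>j<r. g p (?e i p) (?e j p) * w j p) = g p (N p (?e i p)) (Y p)"
    by (rule smooth_solution_of_linear_system[OF manifold trivialization(1)[OF t],
          where G = "\<lambda>i j p. g p (?e i p) (?e j p)" and b = "\<lambda>i p. g p (N p (?e i p)) (Y p)" and r = r])
      (use G b metric_frame_injective[OF t] in auto)
  have "g p (N p u) (Y p) = g p u (\<Sum>j<r. w j p *\<^sub>R ?e j p)" (is "_ = g p u ?W")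
    if p: "p \<in> U" and u: "u \<in> fibre A p" for p u
  proof -
    have W: "?W \<in> fibre A p" by (rule frame_combination(1)[OF t p])
    have lin: "linear_on_fibre (fibre A p) (\<lambda>u. g p (N p u) (Y p))"
      using metric_linear_left[OF Sec_fibre[OF Y], of p] N
      unfolding linear_on_fibre_def bundle_endomorphism_def by simp
    have "g p (?e i p) ?W = g p (N p (?e i p)) (Y p)" if "i < r" for i
      using linear_on_fibre_sum[OF metric_linear[OF frame(1)[OF t p that]] subspace_fibre,
          of "{..<r}" "\<lambda>j. ?e j p" "\<lambda>j. w j p"] frame(1)[OF t p] w(2)[OF p that]
      by (simp add: mult.commute)
    then show ?thesis
      unfolding linear_on_fibre_expansion[OF t p u lin]
        linear_on_fibre_expansion[OF t p u metric_linear_left[OF W]]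
      by simp
  qed
  then show ?thesis using that w(1) by blast
qed

end

locale courant_structure =
  fixes A :: "('m::{t2_space,second_countable_topology}, 'v::real_vector, 'z) courant_scheme"
  assumes courant: "courant_algebroid A"

sublocale courant_structure \<subseteq> metric_bundle A "pairing A"
  by standard (use courant in \<open>simp_all add: courant_algebroid_def\<close>)

context courant_structure
begin

text \<open>
  The description by \<open>THE\<close> is meaningful: the local solution through any section with value \<open>v\<close> gives
  existence, and nondegeneracy gives uniqueness.
\<close>

lemma adjoint_tensor:
  assumes N: "bundle_endomorphism A N" and v: "v \<in> fibre A p"
  shows "adjoint_tensor A N p v \<in> fibre A p"
    and "u \<in> fibre A p \<Longrightarrow> pairing A p (N p u) v = pairing A p u (adjoint_tensor A N p v)"
proof -
  obtain Y where Y: "Y \<in> Sec A" "Y p = v" by (rule exists_section_through[OF v])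
  obtain U r \<Phi> where t: "(U, r, \<Phi>) \<in> trivs A" "p \<in> U" by (rule trivialization_at)
  obtain w where w: "\<And>q u. q \<in> U \<Longrightarrow> u \<in> fibre A q \<Longrightarrow>
      pairing A q (N q u) (Y q) = pairing A q u (\<Sum>j<r. w j q *\<^sub>R frame A \<Phi> j q)"
    by (rule local_adjoint[OF N t(1) Y(1)]) blast
  have "\<exists>!w. w \<in> fibre A p \<and> (\<forall>u\<in>fibre A p. pairing A p (N p u) v = pairing A p u w)"
  proof (rule ex_ex1I)
    show "\<exists>w. w \<in> fibre A p \<and> (\<forall>u\<in>fibre A p. pairing A p (N p u) v = pairing A p u w)"
      using w[OF t(2)] Y(2) frame_combination(1)[OF t, of "\<lambda>j. w j p"]
      by (intro exI[of _ "\<Sum>j<r. w j p *\<^sub>R frame A \<Phi> j p"]) simp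
  qed (metis eq_if_metric_eq)
  from theI'[OF this] show "adjoint_tensor A N p v \<in> fibre A p"
    and "u \<in> fibre A p \<Longrightarrow> pairing A p (N p u) v = pairing A p u (adjoint_tensor A N p v)"
    unfolding adjoint_tensor_def by auto
qed

text \<open>By uniqueness, the adjoint agrees with the smooth local solutions.\<close>

lemma sec_map_adjoint_Sec:
  assumes N: "bundle_endomorphism A N" and Y: "Y \<in> Sec A"
  shows "sec_map (adjoint_tensor A N) Y \<in> Sec A"
proof (rule SecI)
  show "sec_map (adjoint_tensor A N) Y p \<in> fibre A p" for p
    unfolding sec_map_def by (rule adjoint_tensor(1)[OF N Sec_fibre[OF Y]])
  fix U r \<Phi> i assume t: "(U, r, \<Phi>) \<in> trivs A" and i: "i < (r :: nat)"
  obtain w where w: "\<And>j. j < r \<Longrightarrow> smooth_on A U (w j)"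
    "\<And>q u. q \<in> U \<Longrightarrow> u \<in> fibre A q \<Longrightarrow>
      pairing A q (N q u) (Y q) = pairing A q u (\<Sum>j<r. w j q *\<^sub>R frame A \<Phi> j q)"
    by (rule local_adjoint[OF N t Y]) blast
  show "smooth_on A U (\<lambda>p. \<Phi> p (sec_map (adjoint_tensor A N) Y p) i)"
  proof (rule smooth_on_cong_imp[OF manifold trivialization(1)[OF t] _ w(1)[OF i]])
    fix q assume q: "q \<in> U"
    have "adjoint_tensor A N q (Y q) = (\<Sum>j<r. w j q *\<^sub>R frame A \<Phi> j q)"
      by (rule eq_if_metric_eq[OF adjoint_tensor(1)[OF N Sec_fibre[OF Y]] frame_combination(1)[OF t q]])
        (use w(2)[OF q] adjoint_tensor(2)[OF N Sec_fibre[OF Y]] in simp)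
    then show "\<Phi> q (sec_map (adjoint_tensor A N) Y q) i = w i q"
      using frame_combination(2)[OF t q, of "\<lambda>j. w j q" i] i by (simp add: sec_map_def)
  qed
qed


section \<open>Polarization of the Courant algebroid axioms\<close>

abbreviation pair ("\<langle>_, _\<rangle>") where "\<langle>X, Y\<rangle> \<equiv> sec_pair (pairing A) X Y"
abbreviation act where "act X f \<equiv> anchor_act (anchor A) X f"
abbreviation product (infixl "\<star>" 70) where "X \<star> Y \<equiv> bracket A X Y"

lemma pair_sym: "X \<in> Sec A \<Longrightarrow> Y \<in> Sec A \<Longrightarrow> \<langle>X, Y\<rangle> = \<langle>Y, X\<rangle>"
  by (simp add: sec_pair_def metric_sym Sec_fibre)

lemma pair_add:
  assumes "X \<in> Sec A" "Y \<in> Sec A" "Z \<in> Sec A"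
  shows "\<langle>X, sec_add Y Z\<rangle> p = \<langle>X, Y\<rangle> p + \<langle>X, Z\<rangle> p" "\<langle>sec_add Y Z, X\<rangle> p = \<langle>Y, X\<rangle> p + \<langle>Z, X\<rangle> p"
  using assms by (simp_all add: sec_pair_def sec_add_def metric_add Sec_fibre)

lemma bracket_Sec: "X \<in> Sec A \<Longrightarrow> Y \<in> Sec A \<Longrightarrow> X \<star> Y \<in> Sec A"
  using courant by (simp add: courant_algebroid_def leibniz_product_def)

lemma bracket_add:
  assumes "X \<in> Sec A" "Y \<in> Sec A" "Z \<in> Sec A"
  shows "sec_add X Y \<star> Z = sec_add (X \<star> Z) (Y \<star> Z)" "Z \<star> sec_add X Y = sec_add (Z \<star> X) (Z \<star> Y)"
  using courant assms unfolding courant_algebroid_def leibniz_product_def by blast+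

lemma act_square:
  assumes "X \<in> Sec A" "Y \<in> Sec A"
  shows "act X \<langle>Y, Y\<rangle> p = 2 * \<langle>X, Y \<star> Y\<rangle> p" "act X \<langle>Y, Y\<rangle> p = 2 * \<langle>X \<star> Y, Y\<rangle> p"
proof -
  have "\<forall>X\<in>Sec A. \<forall>Y\<in>Sec A. act X \<langle>Y, Y\<rangle> = (\<lambda>p. 2 * \<langle>X, Y \<star> Y\<rangle> p) \<and>
      act X \<langle>Y, Y\<rangle> = (\<lambda>p. 2 * \<langle>X \<star> Y, Y\<rangle> p)"
    using courant unfolding courant_algebroid_def pairing_compatible_def by (elim conjE)
  from bspec[OF bspec[OF this assms(1)] assms(2)]
  show "act X \<langle>Y, Y\<rangle> p = 2 * \<langle>X, Y \<star> Y\<rangle> p" "act X \<langle>Y, Y\<rangle> p = 2 * \<langle>X \<star> Y, Y\<rangle> p"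
    by metis+
qed

lemma act_add:
  assumes "X \<in> Sec A" "smooth_on A UNIV f" "smooth_on A UNIV h"
  shows "act X (\<lambda>q. f q + h q) p = act X f p + act X h p"
proof -
  have "anchor A p (X p) \<in> tangent_space A p"
    using courant Sec_fibre[OF assms(1)] by (simp add: courant_algebroid_def bundle_map_to_tangent_def)
  then show ?thesis using assms(2,3) by (simp add: tangent_space_def anchor_act_def)
qed

text \<open>
  Polarization of the axioms. The derivation is additive on smooth functions only, so this depends on the
  smoothness of the pairing of two sections.
\<close>

lemma act_pair:
  assumes X: "X \<in> Sec A" and Y: "Y \<in> Sec A" and Z: "Z \<in> Sec A"
  shows "act X \<langle>Y, Z\<rangle> p = \<langle>X, Y \<star> Z\<rangle> p + \<langle>X, Z \<star> Y\<rangle> p"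
    and "act X \<langle>Y, Z\<rangle> p = \<langle>X \<star> Y, Z\<rangle> p + \<langle>X \<star> Z, Y\<rangle> p"
proof -
  let ?S = "sec_add Y Z"
  note S = sec_add_Sec[OF Y Z]
  note sm = smooth_on_metric[OF Y Y] smooth_on_metric[OF Y Z] smooth_on_metric[OF Z Z]
  have "\<langle>?S, ?S\<rangle> = (\<lambda>q. \<langle>Y, Y\<rangle> q + (\<langle>Y, Z\<rangle> q + (\<langle>Y, Z\<rangle> q + \<langle>Z, Z\<rangle> q)))"
    by (rule ext) (simp add: pair_add Y Z S pair_sym[OF Z Y])
  then have eq: "act X \<langle>?S, ?S\<rangle> p = act X \<langle>Y, Y\<rangle> p + 2 * act X \<langle>Y, Z\<rangle> p + act X \<langle>Z, Z\<rangle> p"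
    by (simp only: act_add X sm smooth_on_add manifold open_UNIV)
  have "\<langle>X, ?S \<star> ?S\<rangle> p = \<langle>X, Y \<star> Y\<rangle> p + \<langle>X, Y \<star> Z\<rangle> p + \<langle>X, Z \<star> Y\<rangle> p + \<langle>X, Z \<star> Z\<rangle> p"
    by (simp add: bracket_add pair_add bracket_Sec sec_add_Sec X Y Z)
  then show "act X \<langle>Y, Z\<rangle> p = \<langle>X, Y \<star> Z\<rangle> p + \<langle>X, Z \<star> Y\<rangle> p"
    using eq act_square(1)[OF X S, of p] act_square(1)[OF X Y, of p] act_square(1)[OF X Z, of p] by simp
  have "\<langle>X \<star> ?S, ?S\<rangle> p = \<langle>X \<star> Y, Y\<rangle> p + \<langle>X \<star> Y, Z\<rangle> p + \<langle>X \<star> Z, Y\<rangle> p + \<langle>X \<star> Z, Z\<rangle> p"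
    by (simp add: bracket_add pair_add bracket_Sec sec_add_Sec X Y Z)
  then show "act X \<langle>Y, Z\<rangle> p = \<langle>X \<star> Y, Z\<rangle> p + \<langle>X \<star> Z, Y\<rangle> p"
    using eq act_square(2)[OF X S, of p] act_square(2)[OF X Y, of p] act_square(2)[OF X Z, of p] by simp
qed

end


section \<open>The contracted product\<close>

locale courant_tensor = courant_structure A
  for A :: "('m::{t2_space,second_countable_topology}, 'v::real_vector, 'z) courant_scheme" +
  fixes N :: "'m \<Rightarrow> 'v \<Rightarrow> 'v"
  assumes endo: "bundle_endomorphism A N"
begin

text \<open>
  Lower case denotes the operators that \<open>N\<close> and \<open>N + N\<^sup>*\<close> induce on sections.
\<close>

abbreviation n where "n \<equiv> sec_map N"
abbreviation s where "s \<equiv> sec_map (tensor_add N (adjoint_tensor A N))"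

lemma n_Sec: "X \<in> Sec A \<Longrightarrow> n X \<in> Sec A"
  by (rule sec_map_Sec[OF endo])

lemma s_eq: "s X = sec_add (n X) (sec_map (adjoint_tensor A N) X)"
  by (simp add: sec_map_def tensor_add_def sec_add_def)

lemma s_Sec: "X \<in> Sec A \<Longrightarrow> s X \<in> Sec A"
  unfolding s_eq by (intro sec_add_Sec n_Sec sec_map_adjoint_Sec endo)

lemma pair_s:
  assumes "X \<in> Sec A" "Y \<in> Sec A"
  shows "\<langle>X, s Y\<rangle> p = \<langle>X, n Y\<rangle> p + \<langle>n X, Y\<rangle> p"
  using adjoint_tensor(2)[OF endo Sec_fibre[OF assms(2)] Sec_fibre[OF assms(1)], of p] assms
  by (simp add: s_eq pair_add n_Sec sec_map_adjoint_Sec endo)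
    (simp add: sec_pair_def sec_map_def)

lemma s_self_adjoint:
  assumes "X \<in> Sec A" "Y \<in> Sec A"
  shows "\<langle>X, s Y\<rangle> = \<langle>s X, Y\<rangle>"
  using assms pair_sym[OF s_Sec assms(2)] pair_sym[OF n_Sec[OF assms(1)] assms(2)]
    pair_sym[OF assms(1) n_Sec[OF assms(2)]]
  by (simp add: fun_eq_iff pair_s)

text \<open>
  Additivity follows from self-adjointness and nondegeneracy: \<open>\<langle>Z, S(X + Y)\<rangle> = \<langle>SZ, X + Y\<rangle>\<close>.
\<close>

lemma s_add:
  assumes "X \<in> Sec A" "Y \<in> Sec A"
  shows "s (sec_add X Y) = sec_add (s X) (s Y)"
proof (rule sections_eq_if_pairings_eq)
  fix Z p assume "Z \<in> Sec A"
  then show "\<langle>Z, s (sec_add X Y)\<rangle> p = \<langle>Z, sec_add (s X) (s Y)\<rangle> p"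
    using assms by (simp add: s_self_adjoint pair_add s_Sec sec_add_Sec)
qed (use assms in \<open>simp_all add: s_Sec sec_add_Sec\<close>)

text \<open>
  The pairings \<open>\<langle>NY, Y\<rangle>\<close> and \<open>\<langle>Y, N\<^sup>*Y\<rangle>\<close> are the same function; each contributes one half of \<open>\<langle>SY, Y\<rangle>\<close>.
\<close>

lemma act_pair_s:
  assumes X: "X \<in> Sec A" and Y: "Y \<in> Sec A"
  shows "act X \<langle>s Y, Y\<rangle> p = 2 * act X \<langle>n Y, Y\<rangle> p"
proof -
  have "\<langle>s Y, Y\<rangle> = (\<lambda>q. \<langle>n Y, Y\<rangle> q + \<langle>n Y, Y\<rangle> q)"
    using s_self_adjoint[OF Y Y, symmetric] pair_sym[OF n_Sec[OF Y] Y]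
    by (simp add: fun_eq_iff pair_s Y)
  then show ?thesis
    by (simp only: act_add X smooth_on_metric n_Sec Y)
qed

lemma contracted_anchor_act: "anchor_act (contracted_anchor A N) X f = act (n X) f"
  by (simp add: anchor_act_def contracted_anchor_def sec_map_def)

lemma pair_contracted:
  assumes "X \<in> Sec A" "Y \<in> Sec A" "Z \<in> Sec A"
  shows "\<langle>X, contracted_bracket A N Y Z\<rangle> p = \<langle>X, n Y \<star> Z\<rangle> p + \<langle>X, Y \<star> n Z\<rangle> p - \<langle>X, n (Y \<star> Z)\<rangle> p"
    and "\<langle>contracted_bracket A N Y Z, X\<rangle> p = \<langle>n Y \<star> Z, X\<rangle> p + \<langle>Y \<star> n Z, X\<rangle> p - \<langle>n (Y \<star> Z), X\<rangle> p"
  using assms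
  by (simp_all add: contracted_bracket_def sec_pair_def sec_add_def sec_diff_def
      metric_add metric_diff subspace_add subspace_fibre Sec_fibre n_Sec bracket_Sec)

text \<open>
  The derivative \<open>\<rho>(NX)\<langle>Y, Y\<rangle>\<close> is \<open>2\<langle>NX, Y \<circ> Y\<rangle>\<close>. Moving \<open>N\<close> across the pairing produces \<open>S(Y \<circ> Y)\<close>, and the remaining
  terms \<open>\<langle>X, NY \<circ> Y + Y \<circ> NY\<rangle>\<close> equal \<open>\<rho>(X)\<langle>NY, Y\<rangle>\<close>, which is half of \<open>\<rho>(X)\<langle>SY, Y\<rangle>\<close>.
\<close>

lemma first_compatibility_iff:
  assumes X: "X \<in> Sec A" and Y: "Y \<in> Sec A"
  shows "act (n X) \<langle>Y, Y\<rangle> p = 2 * \<langle>X, contracted_bracket A N Y Y\<rangle> p \<longleftrightarrow>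
    2 * \<langle>X, s (Y \<star> Y)\<rangle> p = \<langle>X, s Y \<star> Y\<rangle> p + \<langle>X, Y \<star> s Y\<rangle> p"
proof -
  have "act (n X) \<langle>Y, Y\<rangle> p = 2 * \<langle>n X, Y \<star> Y\<rangle> p"
    by (rule act_square(1)[OF n_Sec[OF X] Y])
  moreover have "\<langle>X, s (Y \<star> Y)\<rangle> p = \<langle>X, n (Y \<star> Y)\<rangle> p + \<langle>n X, Y \<star> Y\<rangle> p"
    by (rule pair_s[OF X bracket_Sec[OF Y Y]])
  moreover have "\<langle>X, s Y \<star> Y\<rangle> p + \<langle>X, Y \<star> s Y\<rangle> p = 2 * (\<langle>X, n Y \<star> Y\<rangle> p + \<langle>X, Y \<star> n Y\<rangle> p)"
    using act_pair_s[OF X Y, of p] act_pair(1)[OF X s_Sec[OF Y] Y, of p]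
      act_pair(1)[OF X n_Sec[OF Y] Y, of p] by simp
  ultimately show ?thesis
    using pair_contracted(1)[OF X Y Y, of p] by argo
qed

text \<open>
  The terms \<open>\<langle>NX \<circ> Y, Y\<rangle>\<close> cancel, which leaves \<open>\<langle>X \<circ> NY - N(X \<circ> Y), Y\<rangle> = 0\<close>. Differentiating
  \<open>\<langle>SY, Y\<rangle> = 2\<langle>NY, Y\<rangle>\<close> along \<open>X\<close> shows that this expression is half of the one with \<open>S\<close> in place of \<open>N\<close>.
\<close>

lemma second_compatibility_iff:
  assumes X: "X \<in> Sec A" and Y: "Y \<in> Sec A"
  shows "act (n X) \<langle>Y, Y\<rangle> p = 2 * \<langle>contracted_bracket A N X Y, Y\<rangle> p \<longleftrightarrow>
    \<langle>X \<star> s Y, Y\<rangle> p = \<langle>s (X \<star> Y), Y\<rangle> p"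
proof -
  note XY = bracket_Sec[OF X Y]
  have "act (n X) \<langle>Y, Y\<rangle> p = 2 * \<langle>n X \<star> Y, Y\<rangle> p"
    by (rule act_square(2)[OF n_Sec[OF X] Y])
  moreover have "\<langle>X \<star> s Y, Y\<rangle> p + \<langle>X \<star> Y, s Y\<rangle> p = 2 * (\<langle>X \<star> n Y, Y\<rangle> p + \<langle>X \<star> Y, n Y\<rangle> p)"
    using act_pair_s[OF X Y, of p] act_pair(2)[OF X s_Sec[OF Y] Y, of p]
      act_pair(2)[OF X n_Sec[OF Y] Y, of p] by simp
  moreover have "\<langle>X \<star> Y, s Y\<rangle> p = \<langle>X \<star> Y, n Y\<rangle> p + \<langle>n (X \<star> Y), Y\<rangle> p"
    by (rule pair_s[OF XY Y])
  ultimately show ?thesis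
    using pair_contracted(2)[OF Y X Y, of p] fun_cong[OF s_self_adjoint[OF XY Y], of p] by argo
qed

definition commutator_form where "commutator_form X Y Z p = \<langle>X \<star> s Y, Z\<rangle> p - \<langle>s (X \<star> Y), Z\<rangle> p"

text \<open>
  Since \<open>X \<circ>\<close> differentiates the pairing, the form equals
  \<open>\<rho>(X)\<langle>SY, Z\<rangle> - \<langle>S(X \<circ> Z), Y\<rangle> - \<langle>S(X \<circ> Y), Z\<rangle>\<close>, in which \<open>Y\<close> and \<open>Z\<close> may be exchanged.
\<close>

lemma commutator_form_sym:
  assumes X: "X \<in> Sec A" and Y: "Y \<in> Sec A" and Z: "Z \<in> Sec A"
  shows "commutator_form X Y Z p = commutator_form X Z Y p"
proof -
  have 1: "commutator_form X Y Z p = act X \<langle>s Y, Z\<rangle> p - \<langle>s (X \<star> Z), Y\<rangle> p - \<langle>s (X \<star> Y), Z\<rangle> p"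
    if "Y \<in> Sec A" "Z \<in> Sec A" for Y Z
    using act_pair(2)[OF X s_Sec that(2), OF that(1), of p] s_self_adjoint[OF bracket_Sec[OF X that(2)] that(1)]
    by (simp add: commutator_form_def)
  have "\<langle>s Y, Z\<rangle> = \<langle>s Z, Y\<rangle>"
    using s_self_adjoint[OF Y Z] pair_sym[OF Y s_Sec[OF Z]] by simp
  then show ?thesis using 1[OF Y Z] 1[OF Z Y] by simp
qed

text \<open>
  A symmetric form that vanishes on the diagonal vanishes, by expanding it at \<open>Y + Z\<close>.
\<close>

lemma s_commutes_if_commutator_form_zero:
  assumes X: "X \<in> Sec A" and Y: "Y \<in> Sec A"
    and 0: "\<And>Y p. Y \<in> Sec A \<Longrightarrow> commutator_form X Y Y p = 0"
  shows "X \<star> s Y = s (X \<star> Y)"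
proof (rule sections_eq_if_pairings_eq)
  show XsY: "X \<star> s Y \<in> Sec A" and sXY: "s (X \<star> Y) \<in> Sec A"
    using X Y by (simp_all add: s_Sec bracket_Sec)
  fix Z p assume Z: "Z \<in> Sec A"
  have "commutator_form X (sec_add Y Z) (sec_add Y Z) p =
      commutator_form X Y Y p + commutator_form X Y Z p + commutator_form X Z Y p + commutator_form X Z Z p"
    using X Y Z by (simp add: commutator_form_def s_add bracket_add pair_add s_Sec bracket_Sec sec_add_Sec)
  then have "commutator_form X Y Z p = 0"
    using 0 Y Z sec_add_Sec[OF Y Z] commutator_form_sym[OF X Y Z, of p] by simp
  then show "\<langle>Z, X \<star> s Y\<rangle> p = \<langle>Z, s (X \<star> Y)\<rangle> p"
    using pair_sym[OF Z XsY] pair_sym[OF Z sXY] by (simp add: commutator_form_def)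
qed

lemma contracted_compatible_iff:
  "(\<forall>X\<in>Sec A. \<forall>Y\<in>Sec A.
      anchor_act (contracted_anchor A N) X \<langle>Y, Y\<rangle> = (\<lambda>p. 2 * \<langle>X, contracted_bracket A N Y Y\<rangle> p) \<and>
      anchor_act (contracted_anchor A N) X \<langle>Y, Y\<rangle> = (\<lambda>p. 2 * \<langle>contracted_bracket A N X Y, Y\<rangle> p)) \<longleftrightarrow>
   (\<forall>X\<in>Sec A. \<forall>Y\<in>Sec A. X \<star> s Y = s (X \<star> Y) \<and> s (Y \<star> Y) = s Y \<star> Y)" (is "?L \<longleftrightarrow> ?R")
proof -
  have "?L \<longleftrightarrow> (\<forall>X\<in>Sec A. \<forall>Y\<in>Sec A. \<forall>p.
      2 * \<langle>X, s (Y \<star> Y)\<rangle> p = \<langle>X, s Y \<star> Y\<rangle> p + \<langle>X, Y \<star> s Y\<rangle> p \<and>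
      \<langle>X \<star> s Y, Y\<rangle> p = \<langle>s (X \<star> Y), Y\<rangle> p)" (is "_ \<longleftrightarrow> ?M")
    by (simp add: contracted_anchor_act fun_eq_iff first_compatibility_iff second_compatibility_iff
        all_conj_distrib cong: ball_cong)
  also have "?M \<longleftrightarrow> ?R"
  proof
    assume M: ?M
    have comm: "X \<star> s Y = s (X \<star> Y)" if "X \<in> Sec A" "Y \<in> Sec A" for X Y
      by (rule s_commutes_if_commutator_form_zero[OF that]) (use M that in \<open>simp add: commutator_form_def\<close>)
    have "s (Y \<star> Y) = s Y \<star> Y" if Y: "Y \<in> Sec A" for Y
    proof (rule sections_eq_if_pairings_eq)
      fix Z p assume "Z \<in> Sec A"
      then have "2 * \<langle>Z, s (Y \<star> Y)\<rangle> p = \<langle>Z, s Y \<star> Y\<rangle> p + \<langle>Z, Y \<star> s Y\<rangle> p" using M Y by blast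
      then show "\<langle>Z, s (Y \<star> Y)\<rangle> p = \<langle>Z, s Y \<star> Y\<rangle> p" using comm[OF Y Y] by simp
    qed (use Y in \<open>simp_all add: s_Sec bracket_Sec\<close>)
    then show ?R using comm by blast
  next
    assume R: ?R
    show ?M
    proof (intro ballI allI)
      fix X Y p assume "X \<in> Sec A" "Y \<in> Sec A"
      then have "X \<star> s Y = s (X \<star> Y)" "Y \<star> s Y = s (Y \<star> Y)" "s (Y \<star> Y) = s Y \<star> Y"
        using R by blast+
      then show "2 * \<langle>X, s (Y \<star> Y)\<rangle> p = \<langle>X, s Y \<star> Y\<rangle> p + \<langle>X, Y \<star> s Y\<rangle> p \<and>
          \<langle>X \<star> s Y, Y\<rangle> p = \<langle>s (X \<star> Y), Y\<rangle> p" by simp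
    qed
  qed
  finally show ?thesis .
qed

end

theorem theorem4:
  fixes A :: "('m::{t2_space,second_countable_topology}, 'v::real_vector) courant"
    and N :: "'m \<Rightarrow> 'v \<Rightarrow> 'v"
  assumes "courant_algebroid A"
    and "bundle_endomorphism A N"
  shows "(\<forall>X\<in>Sec A. \<forall>Y\<in>Sec A.
            anchor_act (contracted_anchor A N) X (sec_pair (pairing A) Y Y)
              = (\<lambda>p. 2 * sec_pair (pairing A) X (contracted_bracket A N Y Y) p) \<and>
            anchor_act (contracted_anchor A N) X (sec_pair (pairing A) Y Y)
              = (\<lambda>p. 2 * sec_pair (pairing A) (contracted_bracket A N X Y) Y p))
     \<longleftrightarrow>
         (\<forall>X\<in>Sec A. \<forall>Y\<in>Sec A.
            bracket A X (sec_map (tensor_add N (adjoint_tensor A N)) Y)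
              = sec_map (tensor_add N (adjoint_tensor A N)) (bracket A X Y) \<and>
            sec_map (tensor_add N (adjoint_tensor A N)) (bracket A Y Y)
              = bracket A (sec_map (tensor_add N (adjoint_tensor A N)) Y) Y)"
proof -
  interpret courant_tensor A N
    by unfold_locales (fact assms)+
  show ?thesis by (rule contracted_compatible_iff)
qed

end
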